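(* Let $N\ge1$ be an integer, $1<p<2$, $q>1$, $\delta=\frac{p}{2-p}$, and suppose $N<\delta$. Set $$\alpha^\ast=\delta+\frac{\delta(N-\delta)}{(p-1)(2\delta-N)}.$$ For $\alpha>0$ and $a\in\mathbb{R}$ let $w(\cdot,a)$ be the solution of $$(|w'|^{p-2}w')'+\frac{N-1}{r}|w'|^{p-2}w'+rw'+\alpha w+|w|^{q-1}w=0\ \text{ in }(0,\infty),\qquad w(0)=a,\quad w'(0)=0.$$ Assume $N\le\alpha<\delta$. (i) If $\alpha<\alpha^\ast$, then any solution $w(\cdot,a)$ with $a\neq0$ has a finite number of zeros. (ii) There exists $\overline\alpha\in(\max(N,\alpha^\ast),\delta)$ such that for any $\alpha\in(\overline\alpha,\delta)$, any solution $w(\cdot,a)$ with $a\ne0$ has infinitely many zeros.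
   Context: For every $\alpha>0$ and $a\in\mathbb{R}$ the initial value problem has a unique solution $w(\cdot,a)\in C^1([0,\infty))$ with $|w'|^{p-2}w'\in C^1([0,\infty))$. *)

theory Defs
  imports "HOL-Analysis.Analysis"
begin

text \<open>\<open>f \<in> C\<^sup>1([0,\<infinity>))\<close> with derivative \<open>f'\<close>; the derivative at \<open>0\<close> is one-sided, so the values
  of \<open>f\<close> on negative reals are irrelevant.\<close>

definition C1_halfline_deriv :: "(real \<Rightarrow> real) \<Rightarrow> (real \<Rightarrow> real) \<Rightarrow> bool" where
  "C1_halfline_deriv f f' \<longleftrightarrow>
     (\<forall>r\<ge>0. (f has_real_derivative f' r) (at r within {0..})) \<and> continuous_on {0..} f'"

text \<open>\<open>\<bar>x\<bar>\<^sup>s x\<close>. For \<open>-1 < s < 0\<close> the usual continuous extension by \<open>0\<close> at \<open>x = 0\<close> is meant,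
  which agrees with \<open>0 powr s = 0\<close>.\<close>

definition signed_power :: "real \<Rightarrow> real \<Rightarrow> real" where
  "signed_power s x = \<bar>x\<bar> powr s * x"

definition is_solution ::
    "nat \<Rightarrow> real \<Rightarrow> real \<Rightarrow> real \<Rightarrow> real \<Rightarrow> (real \<Rightarrow> real) \<Rightarrow> bool" where
  "is_solution N p q \<alpha> a w \<longleftrightarrow>
     (\<exists>w' z'. C1_halfline_deriv w w' \<and>
        C1_halfline_deriv (\<lambda>r. signed_power (p - 2) (w' r)) z' \<and>
        (\<forall>r>0. z' r + (real N - 1) / r * signed_power (p - 2) (w' r) + r * w' r
                 + \<alpha> * w r + signed_power (q - 1) (w r) = 0) \<and>
        w 0 = a \<and> w' 0 = 0)"

definition zeros :: "(real \<Rightarrow> real) \<Rightarrow> real set" where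
  "zeros w = {r. 0 \<le> r \<and> w r = 0}"

definition delta :: "real \<Rightarrow> real" where
  "delta p = p / (2 - p)"

definition alpha_star :: "nat \<Rightarrow> real \<Rightarrow> real" where
  "alpha_star N p =
     delta p + delta p * (real N - delta p) / ((p - 1) * (2 * delta p - real N))"

end

theory Submission
  imports Defs
begin

text \<open>With \<open>\<delta> = delta p\<close>, the substitution \<open>t = ln r\<close>, \<open>y = r\<^sup>\<delta> w\<close>, \<open>Y = - r\<^bsup>\<delta> - 1\<^esup> \<bar>w'\<bar>\<^bsup>p - 2\<^esup> w'\<close>
  turns the equation into an asymptotically autonomous planar system. A Lyapunov-type function of it is
  non-increasing outside a bounded set, and this bounds it by a constant depending on \<open>N, p, q\<close> only.

  If \<open>w\<close> had infinitely many zeros, the orbit would turn around the origin for ever. Such an orbit cannot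
  pass the abscissa of the stationary point of the limit system, so it is eventually confined to a box
  which, for \<open>\<alpha> < \<alpha>\<^sup>*\<close>, lies in the region where the Lyapunov function increases. The orbit then converges to
  the origin, which is impossible because the origin is a source.

  For \<open>\<alpha>\<close> close to \<open>\<delta>\<close> the universal bound lies below the level of the Lyapunov function at its saddle, so \<open>y\<close>
  stays away from the abscissa of the stationary point; an orbit that eventually remains on one side of \<open>y = 0\<close>
  would then have to converge to a stationary point, and none is available.\<close>

section \<open>Signed powers\<close>

text \<open>One factorization decides all signs. In the limit system
  \<open>y' = g (\<phi> y) - g Y = H * (\<phi> y - Y)\<close>, where \<open>H\<close> is the mean
  slope of \<open>g\<close> between \<open>Y\<close> and \<open>\<phi> y\<close>, and the Lyapunov
  function grows at the rate \<open>H * (k - H) * (\<phi> y - Y)\<^sup>2\<close>. So only the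
  comparison of \<open>H\<close> with \<open>k\<close> matters. At a stationary point off the origin
  \<open>H\<close> becomes the derivative of \<open>g\<close>, and \<open>k\<close> minus that
  derivative is the trace of the linearization; \<open>alpha_star\<close> is the value of \<alpha>
  at which this trace vanishes.

  Two obstacles shape the estimates. The source term carries a factor that is unbounded as t tends
  to minus infinity, so a potential for it has to be added before anything is monotone; the
  resulting bound must be free of \<alpha>, because in (ii) the threshold is fixed before \<alpha>.
  In (i) the source must be known to be small before the box is available; this is where N \<le>
  \<alpha> enters. What is left of the source is absorbed by raising \<alpha> to a slightly larger
  \<beta>, and the box is that of the limit system for \<beta>.\<close>

lemma has_real_derivative_abs_powr:
  assumes "1 < s"
  shows "((\<lambda>x. \<bar>x\<bar> powr s) has_real_derivative s * signed_power (s - 2) x) (at x)"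
proof (cases x "0::real" rule: linorder_cases)
  case less
  have "((\<lambda>x. (- x) powr s) has_real_derivative s * signed_power (s - 2) x) (at x)"
    using less by (auto intro!: derivative_eq_intros simp: signed_power_def powr_diff field_simps power2_eq_square)
  then show ?thesis
    by (rule has_field_derivative_transform_within_open[where S="{..<0}"]) (use less in auto)
next
  case greater
  have "((\<lambda>x. x powr s) has_real_derivative s * signed_power (s - 2) x) (at x)"
    using greater by (auto intro!: derivative_eq_intros simp: signed_power_def powr_diff field_simps power2_eq_square)
  then show ?thesis
    by (rule has_field_derivative_transform_within_open[where S="{0<..}"]) (use greater in auto)
next
  case equal
  have "((\<lambda>h. \<bar>h\<bar> powr (s - 1)) \<longlongrightarrow> \<bar>0\<bar> powr (s - 1)) (at 0)"
    using assms by (intro tendsto_powr' tendsto_intros) auto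
  then have "((\<lambda>h. \<bar>h\<bar> powr (s - 1)) \<longlongrightarrow> 0) (at (0::real))"
    by simp
  then have "((\<lambda>h. \<bar>h\<bar> powr s / h) \<longlongrightarrow> 0) (at (0::real))"
    by (rule Lim_null_comparison[rotated]) (auto simp: eventually_at_filter powr_diff)
  then show ?thesis
    using equal by (simp add: DERIV_def signed_power_def)
qed

lemma has_real_derivative_signed_power:
  assumes "0 < s"
  shows "(signed_power s has_real_derivative (s + 1) * \<bar>x\<bar> powr s) (at x)"
proof (cases "x = 0")
  case False
  have "((\<lambda>y. \<bar>y\<bar> powr (s + 1) * sgn x) has_real_derivative
      ((s + 1) * signed_power (s + 1 - 2) x) * sgn x) (at x)"
    using assms by (intro DERIV_cmult_right has_real_derivative_abs_powr) auto
  moreover have "((s + 1) * signed_power (s + 1 - 2) x) * sgn x = (s + 1) * \<bar>x\<bar> powr s"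
    using False by (auto simp: signed_power_def sgn_if abs_if powr_diff field_simps)
  ultimately have *: "((\<lambda>y. \<bar>y\<bar> powr (s + 1) * sgn x) has_real_derivative
      (s + 1) * \<bar>x\<bar> powr s) (at x)" by metis
  have "\<forall>\<^sub>F y in nhds x. sgn y = sgn x"
    using False by (auto simp: eventually_nhds sgn_if intro!: exI[of _ "if 0 < x then {0<..} else {..<0}"])
  then have "\<forall>\<^sub>F y in nhds x. \<bar>y\<bar> powr (s + 1) * sgn x = signed_power s y"
    by eventually_elim (auto simp: signed_power_def powr_add sgn_if abs_if split: if_splits)
  from DERIV_cong_ev[OF refl this refl] * show ?thesis by (rule iffD1)
next
  case True
  have "((\<lambda>h. \<bar>h\<bar> powr s) \<longlongrightarrow> \<bar>0\<bar> powr s) (at 0)"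
    using assms by (intro tendsto_powr' tendsto_intros) auto
  then show ?thesis
    using True assms by (auto simp: DERIV_def signed_power_def intro!: Lim_transform_eventually[where f="\<lambda>h. \<bar>h\<bar> powr s"] simp: eventually_at_filter)
qed

lemma signed_power_minus: "signed_power s (- x) = - signed_power s x"
  by (simp add: signed_power_def)

lemma sgn_signed_power: "sgn (signed_power s x) = sgn x"
  by (auto simp: signed_power_def sgn_mult sgn_if zero_less_mult_iff)

lemma abs_signed_power: "\<bar>signed_power s x\<bar> = \<bar>x\<bar> powr (s + 1)"
  by (auto simp: signed_power_def abs_mult powr_add)

text \<open>Signed powers of reciprocal degrees \<open>s + 1\<close> and \<open>t + 1\<close> are
  mutually inverse. The degrees that matter are \<open>p - 1\<close> and \<open>m\<close>, which
  convert between \<open>w'\<close> and the flux.\<close>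

lemma signed_power_signed_power:
  assumes "(s + 1) * (t + 1) = 1"
  shows "signed_power s (signed_power t x) = x"
proof -
  have "\<bar>signed_power s (signed_power t x)\<bar> = \<bar>x\<bar>"
    using assms by (simp add: abs_signed_power powr_powr mult.commute)
  then show ?thesis
    by (metis abs_sgn sgn_signed_power mult_sgn_abs)
qed

lemma signed_power_mult: "0 < k \<Longrightarrow> signed_power s (k * x) = k powr (s + 1) * signed_power s x"
  by (auto simp: signed_power_def abs_mult powr_mult powr_add)

lemma isCont_signed_power:
  assumes "- 1 < s"
  shows "isCont (signed_power s) x"
proof -
  have "signed_power s = (\<lambda>x. \<bar>x\<bar> powr (s + 1) * sgn x)"
    by (auto simp: signed_power_def fun_eq_iff powr_add sgn_if abs_if)
  moreover have "isCont (\<lambda>x. \<bar>x\<bar> powr (s + 1) * sgn x) x"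
  proof (cases "x = 0")
    case True
    have "((\<lambda>h. \<bar>h\<bar> powr (s+1)) \<longlongrightarrow> \<bar>0\<bar> powr (s+1)) (at 0)"
      using assms by (intro tendsto_powr' tendsto_intros) auto
    then have "((\<lambda>h. \<bar>h\<bar> powr (s+1)) \<longlongrightarrow> 0) (at (0::real))"
      by simp
    then have "((\<lambda>h. \<bar>h\<bar> powr (s+1) * sgn h) \<longlongrightarrow> 0) (at (0::real))"
      by (rule Lim_null_comparison[rotated]) (auto simp: eventually_at_filter abs_mult sgn_if)
    then show ?thesis using True by (simp add: isCont_def)
  next
    case False
    then show ?thesis by (intro continuous_intros) auto
  qed
  ultimately show ?thesis by simp
qed

lemma signed_power_eq_sgn: "signed_power s x = \<bar>x\<bar> powr (s + 1) * sgn x"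
  by (auto simp: signed_power_def powr_add sgn_if abs_if)

lemma signed_power_strict_mono:
  assumes "- 1 < s" "x < y"
  shows "signed_power s x < signed_power s y"
proof -
  consider "0 \<le> x" | "y \<le> 0" | "x < 0" "0 < y" by linarith
  then show ?thesis
  proof cases
    case 3
    then have "signed_power s x < 0" "0 < signed_power s y"
      by (auto simp: signed_power_eq_sgn)
    then show ?thesis by simp
  qed (use assms in \<open>auto simp: signed_power_eq_sgn sgn_if intro: powr_less_mono2\<close>)
qed

section \<open>Calculus on the real line\<close>

lemma last_crossing:
  fixes f :: "real \<Rightarrow> real"
  assumes "continuous_on {a..b} f" "a \<le> b" "f a \<le> C" "C < f b"
  obtains s where "a \<le> s" "s < b" "f s = C" "\<And>u. s < u \<Longrightarrow> u \<le> b \<Longrightarrow> C < f u"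
proof -
  define S where "S = {u \<in> {a..b}. f u \<le> C}"
  have "closed S"
    unfolding S_def by (intro continuous_closed_preimage_constant continuous_on_closed_Collect_le assms continuous_on_const) simp
  moreover have "S \<noteq> {}" "bdd_above S"
    using assms by (auto simp: S_def bdd_above_def)
  ultimately have mem: "Sup S \<in> S"
    by (intro closed_contains_Sup)
  define s where "s = Sup S"
  have s: "a \<le> s" "s \<le> b" "f s \<le> C"
    using mem by (auto simp: S_def s_def)
  then have "s < b" using assms by (cases "s = b") auto
  have gt: "C < f u" if "s < u" "u \<le> b" for u
    using that cSup_upper[OF _ \<open>bdd_above S\<close>, of u] s by (force simp: S_def s_def)
  have "f s = C"
  proof (rule ccontr)
    assume "f s \<noteq> C"
    then have "f s < C" using s by simp
    then obtain x where "s \<le> x" "x \<le> b" "f x = C"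
      using IVT'[of f s C b] s assms continuous_on_subset[OF assms(1), of "{s..b}"] by auto
    with gt[of x] \<open>f s < C\<close> show False by (cases "s = x") auto
  qed
  with s \<open>s < b\<close> gt show ?thesis by (intro that) auto
qed

text \<open>A comparison principle whose initial value is a limit at minus infinity: after the last
  passage through the level \<open>C\<close> the function stays above \<open>C\<close> and hence
  cannot rise.\<close>

lemma le_if_deriv_nonpos_above:
  fixes f :: "real \<Rightarrow> real"
  assumes f': "\<And>t. (f has_real_derivative f' t) (at t)"
    and above: "\<And>t. C < f t \<Longrightarrow> f' t \<le> 0"
    and lim: "(f \<longlongrightarrow> l) at_bot" "l < C"
  shows "f t \<le> C"
proof (rule ccontr)
  assume "\<not> f t \<le> C"
  have "\<forall>\<^sub>F s in at_bot. f s < C"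
    using lim by (rule order_tendstoD)
  then obtain t1 where t1: "\<And>s. s \<le> t1 \<Longrightarrow> f s < C"
    by (auto simp: eventually_at_bot_linorder)
  have cont: "continuous_on A f" for A
    by (auto intro!: continuous_at_imp_continuous_on DERIV_isCont[OF f'])
  obtain s where s: "s < t" "f s = C" "\<And>u. s < u \<Longrightarrow> u \<le> t \<Longrightarrow> C < f u"
    using last_crossing[OF cont, of "min t t1" t C] t1[of "min t t1"] \<open>\<not> f t \<le> C\<close>
    by (metis less_eq_real_def linorder_not_less min.cobounded1 min.cobounded2)
  have "f t \<le> f s"
    using s by (intro DERIV_nonpos_imp_decreasing_open[OF _ _ cont]) (auto intro!: exI[of _ "f' _"] f' above)
  with s \<open>\<not> f t \<le> C\<close> show False by simp
qed

lemma mono_bounded_tendsto_at_top: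
  fixes f :: "real \<Rightarrow> real"
  assumes mono: "\<And>s t. T \<le> s \<Longrightarrow> s \<le> t \<Longrightarrow> f s \<le> f t"
    and bdd: "\<And>t. T \<le> t \<Longrightarrow> f t \<le> B"
  obtains l where "(f \<longlongrightarrow> l) at_top" "\<And>t. T \<le> t \<Longrightarrow> f t \<le> l"
proof
  let ?l = "SUP t\<in>{T..}. f t"
  have bdd': "bdd_above (f ` {T..})"
    using bdd by (auto simp: bdd_above_def)
  show le: "f t \<le> ?l" if "T \<le> t" for t
    using that by (auto intro: cSUP_upper bdd')
  show "(f \<longlongrightarrow> ?l) at_top"
  proof (rule increasing_tendsto)
    show "\<forall>\<^sub>F t in at_top. f t \<le> ?l"
      using eventually_ge_at_top[of T] by eventually_elim (rule le)
    fix x assume "x < ?l"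
    then obtain s where "T \<le> s" "x < f s"
      using bdd' by (subst (asm) less_cSUP_iff) auto
    with mono show "\<forall>\<^sub>F t in at_top. x < f t"
      by (intro eventually_mono[OF eventually_ge_at_top[of s]]) (blast intro: less_le_trans)
  qed
qed

text \<open>If \<open>f\<close> has size \<open>e\<close> at a late time, its Lipschitz bound keeps
  it above \<open>e / 2\<close> for a fixed duration, and \<open>F\<close> gains a fixed amount
  meanwhile. A monotone bounded \<open>F\<close> cannot do this arbitrarily late.\<close>

lemma barbalat_square:
  fixes F f :: "real \<Rightarrow> real"
  assumes F': "\<And>t. T \<le> t \<Longrightarrow> (F has_real_derivative F' t) (at t)"
    and ge: "\<And>t. T \<le> t \<Longrightarrow> c * (f t)\<^sup>2 \<le> F' t"
    and "0 < c"
    and bdd: "\<And>t. T \<le> t \<Longrightarrow> F t \<le> B"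
    and f': "\<And>t. T \<le> t \<Longrightarrow> (f has_real_derivative f' t) (at t)"
    and lip: "\<And>t. T \<le> t \<Longrightarrow> \<bar>f' t\<bar> \<le> K"
  shows "(f \<longlongrightarrow> 0) at_top"
proof -
  have mono: "F s \<le> F t" if "T \<le> s" "s \<le> t" for s t
  proof (rule DERIV_nonneg_imp_nondecreasing[OF that(2)])
    fix u assume "s \<le> u" "u \<le> t"
    moreover have "0 \<le> c * (f u)\<^sup>2" using \<open>0 < c\<close> by simp
    ultimately show "\<exists>y. (F has_real_derivative y) (at u) \<and> 0 \<le> y"
      using that F'[of u] ge[of u] by (intro exI[of _ "F' u"]) linarith
  qed
  obtain l where lim: "(F \<longlongrightarrow> l) at_top" and le: "\<And>t. T \<le> t \<Longrightarrow> F t \<le> l"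
    using mono_bounded_tendsto_at_top[of T F B] mono bdd by blast
  show ?thesis
  proof (rule tendstoI)
    fix e :: real assume "0 < e"
    define K' where "K' = max K 1"
    define h where "h = e / (2 * K')"
    have "0 < K'" "K \<le> K'" by (auto simp: K'_def)
    have "0 < h" using \<open>0 < e\<close> \<open>0 < K'\<close> by (simp add: h_def)
    define \<eta> where "\<eta> = c * (e / 2)\<^sup>2 * h"
    have "0 < \<eta>" using \<open>0 < c\<close> \<open>0 < e\<close> \<open>0 < h\<close> by (simp add: \<eta>_def)
    then have "\<forall>\<^sub>F t in at_top. l - \<eta> < F t"
      by (intro order_tendstoD(1)[OF lim]) simp
    then show "\<forall>\<^sub>F t in at_top. dist (f t) 0 < e"
      using eventually_ge_at_top[of T]
    proof eventually_elim
      case (elim t)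
      show ?case
      proof (rule ccontr)
        assume "\<not> ?case"
        then have ft: "e \<le> \<bar>f t\<bar>" by simp
        have half: "(e / 2)\<^sup>2 \<le> (f s)\<^sup>2" if "t \<le> s" "s \<le> t + h" for s
        proof -
          have "\<bar>f s - f t\<bar> \<le> K' * \<bar>s - t\<bar>"
          proof (cases "s = t")
            case False
            then have "t < s" using that by simp
            then obtain z where "t < z" "z < s" "f s - f t = (s - t) * f' z"
              using MVT2[of t s f f'] f' elim(2) by force
            moreover from this have "\<bar>f' z\<bar> \<le> K'"
              using lip[of z] \<open>K \<le> K'\<close> elim(2) by simp
            ultimately show ?thesis
              using \<open>t < s\<close> by (simp add: abs_mult mult.commute mult_right_mono)
          qed simp
          also have "\<dots> \<le> K' * h" using that \<open>0 < K'\<close> by simp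
          also have "\<dots> = e / 2" using \<open>0 < K'\<close> by (simp add: h_def)
          finally have "e / 2 \<le> \<bar>f s\<bar>" using ft by linarith
          then show ?thesis using \<open>0 < e\<close> by (simp add: abs_le_square_iff[symmetric])
        qed
        have "F t - c * (e / 2)\<^sup>2 * t \<le> F (t + h) - c * (e / 2)\<^sup>2 * (t + h)"
        proof (rule DERIV_nonneg_imp_nondecreasing[where f="\<lambda>t. F t - c * (e / 2)\<^sup>2 * t"])
          show "t \<le> t + h" using \<open>0 < h\<close> by simp
          fix s assume s: "t \<le> s" "s \<le> t + h"
          then have D: "(F has_real_derivative F' s) (at s)" "c * (f s)\<^sup>2 \<le> F' s"
            using F'[of s] ge[of s] elim by auto
          moreover have "c * (e / 2)\<^sup>2 \<le> c * (f s)\<^sup>2"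
            using half[OF s] \<open>0 < c\<close> by simp
          ultimately show "\<exists>D. ((\<lambda>t. F t - c * (e / 2)\<^sup>2 * t) has_real_derivative D) (at s) \<and> 0 \<le> D"
            by (intro exI[of _ "F' s - c * (e / 2)\<^sup>2"]) (auto intro!: derivative_eq_intros)
        qed
        then have "F t + \<eta> \<le> F (t + h)" by (simp add: \<eta>_def algebra_simps)
        with elim le[of "t + h"] \<open>0 < h\<close> show False by simp
      qed
    qed
  qed
qed

lemma exp_neg_tendsto_0:
  fixes k :: real
  assumes "0 < k"
  shows "((\<lambda>t. exp (- k * t)) \<longlongrightarrow> 0) at_top"
  using assms by (intro filterlim_compose[OF exp_at_bot]
    filterlim_tendsto_neg_mult_at_bot[OF tendsto_const _ filterlim_ident]) simp

lemma hump_max: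
  fixes f :: "real \<Rightarrow> real"
  assumes f': "\<And>t. (f has_real_derivative f' t) (at t)"
    and "f s \<le> 0" "f u \<le> 0" "s \<le> t" "t \<le> u" "0 < f t"
  obtains x where "s < x" "x < u" "f t \<le> f x" "f' x = 0" "\<And>z. s \<le> z \<Longrightarrow> z \<le> u \<Longrightarrow> f z \<le> f x"
proof -
  have cont: "continuous_on A f" for A
    by (auto intro!: continuous_at_imp_continuous_on DERIV_isCont[OF f'])
  obtain x where x: "x \<in> {s..u}" and max: "\<And>z. z \<in> {s..u} \<Longrightarrow> f z \<le> f x"
    using continuous_attains_sup[of "{s..u}" f] cont assms by auto
  have "f t \<le> f x" using max assms by auto
  then have "x \<noteq> s" "x \<noteq> u" using assms by auto
  then have su: "s < x" "x < u" using x by auto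
  have "f' x = 0"
  proof (rule DERIV_local_max[OF f'])
    show "0 < min (x - s) (u - x)" using su by simp
    show "\<forall>z. \<bar>x - z\<bar> < min (x - s) (u - x) \<longrightarrow> f z \<le> f x"
      by (intro allI impI max) auto
  qed
  with su \<open>f t \<le> f x\<close> max show ?thesis by (intro that) auto
qed

lemma tendsto_deriv_at_top_imp_0:
  fixes f f' :: "real \<Rightarrow> real"
  assumes f': "\<And>t. (f has_real_derivative f' t) (at t)"
    and f: "(f \<longlongrightarrow> a) at_top" and b: "(f' \<longlongrightarrow> b) at_top"
  shows "b = 0"
proof (rule ccontr)
  assume "b \<noteq> 0"
  have "((\<lambda>t. f (t + 1) - f t) \<longlongrightarrow> a - a) at_top"
    by (intro tendsto_diff f filterlim_compose[OF f] filterlim_tendsto_add_at_top[OF tendsto_const filterlim_ident, of 1, simplified add.commute])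
  then have "\<forall>\<^sub>F t in at_top. \<bar>f (t + 1) - f t\<bar> < \<bar>b\<bar> / 2"
    using \<open>b \<noteq> 0\<close> by (auto dest!: tendstoD[where e="\<bar>b\<bar> / 2"])
  moreover have "\<forall>\<^sub>F t in at_top. \<bar>f' t - b\<bar> < \<bar>b\<bar> / 2"
    using tendstoD[OF b, of "\<bar>b\<bar> / 2"] \<open>b \<noteq> 0\<close> by (simp add: dist_real_def)
  ultimately obtain t where t: "\<And>s. t \<le> s \<Longrightarrow> \<bar>f (s + 1) - f s\<bar> < \<bar>b\<bar> / 2 \<and> \<bar>f' s - b\<bar> < \<bar>b\<bar> / 2"
    using eventually_conj unfolding eventually_at_top_linorder by (smt (verit) eventually_at_top_linorder)
  obtain z where "t < z" "f (t + 1) - f t = f' z"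
    using MVT2[of t "t + 1" f f'] f' by auto
  with t[of t] t[of z] show False by linarith
qed

section \<open>The planar system and its Lyapunov function\<close>

locale fast_diffusion =
  fixes n p q :: real
  assumes n: "1 \<le> n" and p: "1 < p" "p < 2" and q: "1 < q" and n_less: "n < delta p"
begin

text \<open>\<open>g\<close> recovers \<open>w'\<close> from the flux, so the curve
  \<open>Y = \<phi> y\<close> is where \<open>y'\<close> vanishes. \<open>k\<close> is the trace of
  the linear part of the limit system at the origin, and \<open>c\<close> is the decay rate in the
  factor \<open>exp (- c * t)\<close> of the source.\<close>

abbreviation "d \<equiv> delta p"
abbreviation "m \<equiv> 1 / (p - 1)"
abbreviation "g \<equiv> signed_power (m - 1)"
abbreviation "\<phi> x \<equiv> signed_power (p - 2) (d * x)"
abbreviation "k \<equiv> 2 * d - n"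
abbreviation "c \<equiv> d * (q - 1)"

lemma d_gt: "1 < d" and k_pos: "0 < k" and c_pos: "0 < c" and m_gt: "1 < m"
  and p_conj: "1 / p + 1 / (m + 1) = 1"
  using n n_less p q by (auto simp: field_simps)

text \<open>This identity makes the powers of r cancel in \<open>g Y\<close>, so that the
  transformed system depends on time through the source only.\<close>

lemma d_m: "(d - 1) * m = d + 1"
proof -
  have "d - 1 = 2 * (p - 1) / (2 - p)" "d + 1 = 2 / (2 - p)"
    using p by (auto simp: delta_def field_simps)
  then show ?thesis using p by (simp add: divide_simps) (simp add: algebra_simps)
qed

section \<open>Slope estimates for the nonlinearity \<open>g\<close>\<close>

lemma g_deriv: "(g has_real_derivative m * \<bar>x\<bar> powr (m - 1)) (at x)"
  using has_real_derivative_signed_power[of "m - 1" x] m_gt by simp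

lemma g_\<phi>: "g (\<phi> x) = d * x"
  by (rule signed_power_signed_power) (use p in \<open>simp add: field_simps\<close>)

lemma inv_g: "signed_power (p - 2) (g x) = x"
  by (rule signed_power_signed_power) (use p in \<open>simp add: field_simps\<close>)

lemma g_strict_mono: "x < z \<Longrightarrow> g x < g z"
  by (rule signed_power_strict_mono) (use p in auto)

lemma g_mono: "x \<le> z \<Longrightarrow> g x \<le> g z"
  using g_strict_mono by (cases "x = z") (auto simp: less_eq_real_def)

lemma g_0 [simp]: "g 0 = 0"
  by (simp add: signed_power_def)

lemma abs_g_le:
  assumes "\<bar>x\<bar> \<le> Z"
  shows "\<bar>g x\<bar> \<le> Z powr (m - 1) * \<bar>x\<bar>"
  using assms m_gt by (auto simp: signed_power_def abs_mult intro!: mult_right_mono powr_mono2)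

text \<open>\<open>H\<close> is the mean slope of \<open>g\<close>, the quantity to be compared with
  \<open>k\<close>. Its upper bound comes from the mean value theorem, since the derivative of
  \<open>g\<close> increases with the modulus of its argument.\<close>

lemma g_increment:
  obtains H where "g z - g x = H * (z - x)" "0 \<le> H"
    "\<And>Z. \<bar>x\<bar> \<le> Z \<Longrightarrow> \<bar>z\<bar> \<le> Z \<Longrightarrow> H \<le> m * Z powr (m - 1)"
proof -
  have *: "\<exists>H. g z - g x = H * (z - x) \<and> 0 \<le> H \<and>
    (\<forall>Z. \<bar>x\<bar> \<le> Z \<longrightarrow> \<bar>z\<bar> \<le> Z \<longrightarrow> H \<le> m * Z powr (m - 1))" if lt: "x < z" for x z
  proof -
    obtain u where "x < u" "u < z" "g z - g x = (z - x) * (m * \<bar>u\<bar> powr (m - 1))"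
      using MVT2[OF lt g_deriv] by blast
    then show ?thesis
      using m_gt p by (intro exI[of _ "m * \<bar>u\<bar> powr (m - 1)"]) (auto intro!: divide_right_mono powr_mono2)
  qed
  have "\<exists>H. g z - g x = H * (z - x) \<and> 0 \<le> H \<and>
    (\<forall>Z. \<bar>x\<bar> \<le> Z \<longrightarrow> \<bar>z\<bar> \<le> Z \<longrightarrow> H \<le> m * Z powr (m - 1))"
  proof (cases x z rule: linorder_cases)
    case less then show ?thesis by (rule *)
  next
    case equal then show ?thesis using p by (intro exI[of _ 0]) auto
  next
    case greater
    from *[OF this] show ?thesis by (smt (verit) minus_diff_eq mult_minus_right)
  qed
  then show ?thesis using that by blast
qed

text \<open>By oddness and symmetry \<open>z\<close> may be taken as the argument of larger modulus,
  with \<open>z\<close> nonnegative. For \<open>x\<close> of the same sign the mean slope is at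
  least \<open>z powr (m - 1)\<close>; for the opposite sign \<open>z\<close> is still at least half
  of \<open>z - x\<close>, which costs the factor 1/2.\<close>

lemma g_increment_lower:
  "max \<bar>x\<bar> \<bar>z\<bar> powr (m - 1) / 2 * (z - x)\<^sup>2 \<le> (g z - g x) * (z - x)"
proof -
  have *: "\<bar>z\<bar> powr (m - 1) / 2 * (z - x)\<^sup>2 \<le> (g z - g x) * (z - x)" if "\<bar>x\<bar> \<le> z" for x z
  proof -
    have average: "a \<le> b \<Longrightarrow> b \<le> e \<Longrightarrow> a + (e - b) / 2 \<le> e" for a b e :: real
      by (simp add: field_simps)
    have "z powr (m - 1) / 2 * (z - x) \<le> g z - g x"
    proof (cases "0 \<le> x")
      case True
      from True have "x powr (m - 1) * x \<le> z powr (m - 1) * x"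
        using that m_gt by (intro mult_right_mono powr_mono2) auto
      moreover have "0 \<le> z powr (m - 1) * (z - x)" using that by simp
      ultimately have "x powr (m - 1) * x + z powr (m - 1) * (z - x) / 2 \<le> z powr (m - 1) * z"
        using average[of "x powr (m - 1) * x" "z powr (m - 1) * x" "z powr (m - 1) * z"]
        by (simp add: right_diff_distrib)
      then show ?thesis using that True by (simp add: signed_power_def algebra_simps)
    next
      case False
      then have "z powr (m - 1) * (z + x) \<ge> 0" "g x \<le> 0"
        using that by (auto simp: signed_power_def mult_nonneg_nonpos)
      moreover have "a \<le> 0 \<Longrightarrow> 0 \<le> b + e \<Longrightarrow> a + (b - e) / 2 \<le> b" for a b e :: real
        by (simp add: field_simps)
      from this[of "g x" "z powr (m - 1) * z" "z powr (m - 1) * x"] calculation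
      show ?thesis using that
        by (simp add: signed_power_def algebra_simps)
    qed
    from mult_right_mono[OF this, of "z - x"] that show ?thesis
      by (simp add: power2_eq_square mult.assoc)
  qed
  consider "\<bar>x\<bar> \<le> z" | "\<bar>x\<bar> \<le> - z" | "\<bar>z\<bar> \<le> x" | "\<bar>z\<bar> \<le> - x" by linarith
  then show ?thesis
  proof cases
    case 1 then show ?thesis using *[of x z] by (simp add: max_def)
  next
    case 2 then show ?thesis using *[of "- x" "- z"]
      by (simp add: max_def signed_power_minus power2_eq_square algebra_simps)
  next
    case 3 then show ?thesis using *[of z x] by (simp add: max_def power2_eq_square algebra_simps)
  next
    case 4 then show ?thesis using *[of "- z" "- x"]
      by (simp add: max_def signed_power_minus power2_eq_square algebra_simps)
  qed
qed

end

section \<open>A level for the Lyapunov function that does not depend on \<alpha>\<close>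

context fast_diffusion
begin

text \<open>\<open>radius\<close> is chosen so that the mean slope of \<open>g\<close> between \<open>x\<close> and \<open>z\<close> exceeds \<open>k\<close> as soon as
  \<open>max \<bar>x\<bar> \<bar>z\<bar> \<ge> radius\<close> (see \<open>g_increment_lower\<close>).\<close>

definition radius :: real where "radius = (2 * k) powr (1 / (m - 1))"

text \<open>The summands majorize, in order, the first three terms of \<open>W\<close> and the
  potential \<open>S\<close> at points where the derivative of \<open>W + S\<close> is positive; the
  1 puts the level strictly above the limit 0 at minus infinity. \<alpha> is absent because its term
  in \<open>W\<close> is nonpositive for \<alpha> below \<open>d\<close>.\<close>

definition lyapunov_bound :: real where
  "lyapunov_bound = k / d * (radius powr m) powr p / p + radius powr (m + 1) / (m + 1)
     + radius powr m * radius + 4 * k\<^sup>2 * radius\<^sup>2 / c + 1"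

lemma lyapunov_bound_pos: "0 < lyapunov_bound"
proof -
  have "0 \<le> radius" by (simp add: radius_def)
  then show ?thesis
    unfolding lyapunov_bound_def using k_pos c_pos d_gt p q m_gt
    by (intro add_nonneg_pos add_nonneg_nonneg divide_nonneg_nonneg mult_nonneg_nonneg) auto
qed

end

text \<open>The limits at minus infinity encode the behaviour of the radial solution at r = 0. The
  factor \<open>exp (- c * t)\<close> blows up there, which is why the source has a limit condition
  of its own; \<open>nontrivial\<close> reflects a nonzero initial value.\<close>

locale shooting = fast_diffusion +
  fixes \<alpha> :: real and y Y :: "real \<Rightarrow> real"
  assumes \<alpha>: "0 < \<alpha>" "\<alpha> < d"
    and y_deriv: "\<And>t. (y has_real_derivative d * y t - g (Y t)) (at t)"
    and Y_deriv: "\<And>t. (Y has_real_derivative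
          (d - n) * Y t + (\<alpha> + exp (- c * t) * \<bar>y t\<bar> powr (q - 1)) * y t - g (Y t)) (at t)"
    and y_at_bot: "(y \<longlongrightarrow> 0) at_bot"
    and Y_at_bot: "(Y \<longlongrightarrow> 0) at_bot"
    and source_at_bot: "((\<lambda>t. exp (- c * t) * \<bar>y t\<bar> powr (q + 1)) \<longlongrightarrow> 0) at_bot"
    and nontrivial: "\<exists>t. \<forall>s\<le>t. y s \<noteq> 0"
begin

text \<open>In \<open>W\<close> the first three terms are the gap in Young's inequality for \<open>d * y\<close> and \<open>Y\<close>, up to a
  multiple of \<open>\<bar>y\<bar>\<^sup>p\<close> chosen to make \<open>W'\<close> factor; \<open>S\<close> is the potential of the non-autonomous term.\<close>

definition h where "h t = exp (- c * t) * \<bar>y t\<bar> powr (q - 1)"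
definition v where "v t = d * y t - g (Y t)"
definition V where "V t = (d - n) * Y t + (\<alpha> + h t) * y t - g (Y t)"
definition S where "S t = exp (- c * t) * \<bar>y t\<bar> powr (q + 1) / (q + 1)"
definition W where "W t = k / d * \<bar>d * y t\<bar> powr p / p + \<bar>Y t\<bar> powr (m + 1) / (m + 1)
    - d * y t * Y t - (d - \<alpha>) * (y t)\<^sup>2 / 2"

lemma h_nonneg: "0 \<le> h t" by (simp add: h_def)
lemma S_nonneg: "0 \<le> S t" using q by (simp add: S_def)

lemma y_deriv_v: "(y has_real_derivative v t) (at t)"
  using y_deriv by (simp add: v_def)

lemma Y_deriv_V: "(Y has_real_derivative V t) (at t)"
  using Y_deriv by (simp add: V_def h_def)

lemma v_deriv: "(v has_real_derivative d * v t - m * \<bar>Y t\<bar> powr (m - 1) * V t) (at t)"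
  unfolding v_def[abs_def]
  by (auto intro!: derivative_eq_intros y_deriv_v Y_deriv_V DERIV_chain2[OF g_deriv] simp: v_def)

lemma continuous_y: "continuous_on A y"
  by (auto intro!: continuous_at_imp_continuous_on DERIV_isCont[OF y_deriv_v])

lemma continuous_Y: "continuous_on A Y"
  by (auto intro!: continuous_at_imp_continuous_on DERIV_isCont[OF Y_deriv_V])

lemma S_deriv: "(S has_real_derivative h t * y t * v t - c * S t) (at t)"
proof -
  have "((\<lambda>t. \<bar>y t\<bar> powr (q + 1)) has_real_derivative ((q + 1) * signed_power (q + 1 - 2) (y t)) * v t) (at t)"
    by (rule DERIV_chain2[OF has_real_derivative_abs_powr y_deriv_v]) (use q in auto)
  note D = DERIV_cdivide[OF DERIV_mult[OF DERIV_chain2[OF DERIV_exp DERIV_cmult_Id[of "- c"]] this], of "q + 1"]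
  have "S = (\<lambda>t. exp (- c * t) * \<bar>y t\<bar> powr (q + 1) / (q + 1))"
    by (simp add: S_def fun_eq_iff)
  moreover have "(exp (- c * t) * (- c) * \<bar>y t\<bar> powr (q + 1)
      + (q + 1) * signed_power (q + 1 - 2) (y t) * v t * exp (- c * t)) / (q + 1)
    = h t * y t * v t - c * S t"
    using q by (simp add: S_def h_def signed_power_def field_simps)
  ultimately show ?thesis using D by (simp only:)
qed

lemma W_deriv:
  "(W has_real_derivative v t * (k * (\<phi> (y t) - Y t) - v t) - h t * y t * v t) (at t)"
proof -
  have 1: "((\<lambda>t. \<bar>d * y t\<bar> powr p) has_real_derivative (p * \<phi> (y t)) * (d * v t)) (at t)"
    by (rule DERIV_chain2[OF has_real_derivative_abs_powr]) (use p in \<open>auto intro!: derivative_eq_intros y_deriv_v\<close>)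
  have 2: "((\<lambda>t. \<bar>Y t\<bar> powr (m + 1)) has_real_derivative ((m + 1) * g (Y t)) * V t) (at t)"
    using DERIV_chain2[OF has_real_derivative_abs_powr Y_deriv_V, of "m + 1"] p by simp
  have "(W has_real_derivative k / d * ((p * \<phi> (y t)) * (d * v t)) / p
      + ((m + 1) * g (Y t)) * V t / (m + 1) - (d * v t * Y t + d * y t * V t)
      - (d - \<alpha>) * (2 * y t * v t) / 2) (at t)"
    unfolding W_def[abs_def]
    by (rule DERIV_diff DERIV_add DERIV_cdivide DERIV_cmult 1 2 | rule derivative_eq_intros y_deriv_v Y_deriv_V refl | simp)+
  moreover have "k / d * ((p * \<phi> (y t)) * (d * v t)) / p = k * \<phi> (y t) * v t"
    using d_gt p by simp
  moreover have "((m + 1) * g (Y t)) * V t / (m + 1) = g (Y t) * V t"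
    using m_gt by simp
  moreover have "k * \<phi> (y t) * v t + g (Y t) * V t - (d * v t * Y t + d * y t * V t) - (d - \<alpha>) * (2 * y t * v t) / 2
      = v t * (k * (\<phi> (y t) - Y t) - v t) - h t * y t * v t"
    unfolding v_def V_def by (simp add: field_simps)
  ultimately show ?thesis by (simp only:)
qed

text \<open>Adding \<open>S\<close> cancels the indefinite term \<open>h t * y t * v t\<close>; the
  explicit time dependence of \<open>S\<close> contributes only \<open>- c * S t\<close>, which has
  the good sign.\<close>

lemma W_S_deriv:
  "((\<lambda>t. W t + S t) has_real_derivative v t * (k * (\<phi> (y t) - Y t) - v t) - c * S t) (at t)"
  using DERIV_add[OF W_deriv S_deriv] by simp

lemma W_S_at_bot: "((\<lambda>t. W t + S t) \<longlongrightarrow> 0) at_bot"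
proof -
  have 1: "((\<lambda>t. \<bar>d * y t\<bar> powr p) \<longlongrightarrow> \<bar>d * 0\<bar> powr p) at_bot"
    by (intro tendsto_powr' tendsto_intros y_at_bot) (use p in auto)
  have 2: "((\<lambda>t. \<bar>Y t\<bar> powr (m + 1)) \<longlongrightarrow> \<bar>0\<bar> powr (m + 1)) at_bot"
    by (intro tendsto_powr' tendsto_intros Y_at_bot) (use p in \<open>auto simp: field_simps\<close>)
  have "((\<lambda>t. W t + S t) \<longlongrightarrow> k / d * \<bar>d * 0\<bar> powr p / p + \<bar>0\<bar> powr (m + 1) / (m + 1)
    - d * 0 * 0 - (d - \<alpha>) * 0\<^sup>2 / 2 + 0 / (q + 1)) at_bot"
    unfolding W_def S_def
    by (intro tendsto_intros 1 2 y_at_bot Y_at_bot source_at_bot) (use d_gt p q in \<open>auto simp: field_simps\<close>)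
  then show ?thesis by simp
qed

text \<open>A positive derivative forces two things at once: the mean slope of \<open>g\<close> is
  below \<open>k\<close>, which confines \<open>Y\<close> and \<open>\<phi> y\<close> to a fixed
  box, and \<open>c * S t\<close> is beaten by a quantity bounded in that box. The second point is
  needed because \<open>S\<close> is not a function of the position alone.\<close>

lemma W_S_le: "W t + S t \<le> lyapunov_bound"
proof (rule le_if_deriv_nonpos_above[OF W_S_deriv _ W_S_at_bot lyapunov_bound_pos])
  fix t assume above: "lyapunov_bound < W t + S t"
  show "v t * (k * (\<phi> (y t) - Y t) - v t) - c * S t \<le> 0"
  proof (rule ccontr)
    assume neg: "\<not> v t * (k * (\<phi> (y t) - Y t) - v t) - c * S t \<le> 0"
    define x where "x = \<phi> (y t) - Y t"
    define M where "M = max \<bar>Y t\<bar> \<bar>\<phi> (y t)\<bar>"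
    have pos: "c * S t < v t * (k * x - v t)"
      using neg by (simp add: x_def)
    have "0 \<le> c * S t" using c_pos S_nonneg by simp
    have v: "v t = g (\<phi> (y t)) - g (Y t)"
      by (simp add: g_\<phi> v_def)
    have vx: "M powr (m - 1) / 2 * x\<^sup>2 \<le> v t * x"
      unfolding v x_def M_def by (rule g_increment_lower)
    have lt: "(v t)\<^sup>2 < k * (v t * x)" 
      using pos \<open>0 \<le> c * S t\<close> by (simp add: power2_eq_square algebra_simps)
    have "v t \<noteq> 0" "x \<noteq> 0" using lt by auto
    \<comment> \<open>After cancelling the positive factor \<open>v t * x\<close> this says that the
      mean slope \<open>v t / x\<close> is less than \<open>k\<close>.\<close>
    have "(v t * x)\<^sup>2 < k * (v t * x) * x\<^sup>2"
      using mult_strict_right_mono[OF lt, of "x\<^sup>2"] \<open>x \<noteq> 0\<close> by (simp add: power_mult_distrib)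
    moreover have "0 < v t * x"
      using lt k_pos by (smt (verit) mult_nonneg_nonpos zero_le_power2)
    ultimately have vx': "v t * x < k * x\<^sup>2"
      using mult_less_cancel_left_pos[of "v t * x" "v t * x" "k * x\<^sup>2"]
      by (simp add: power2_eq_square mult_ac)
    with vx have "M powr (m - 1) / 2 * x\<^sup>2 < k * x\<^sup>2" by linarith
    then have "M powr (m - 1) < 2 * k" using \<open>x \<noteq> 0\<close> by simp
    then have "(M powr (m - 1)) powr (1 / (m - 1)) < (2 * k) powr (1 / (m - 1))"
      by (intro powr_less_mono2) (use m_gt in auto)
    moreover have "(M powr (m - 1)) powr (1 / (m - 1)) = M"
      using p unfolding powr_powr by (simp add: M_def)
    ultimately have "M < radius" by (simp add: radius_def)
    then have Y: "\<bar>Y t\<bar> \<le> radius" and \<phi>: "\<bar>\<phi> (y t)\<bar> \<le> radius" by (auto simp: M_def)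
    have dy: "\<bar>d * y t\<bar> \<le> radius powr m"
      using \<phi> p abs_signed_power[of "m - 1" "\<phi> (y t)"] by (auto simp: g_\<phi> intro!: powr_mono2)
    have "\<bar>x\<bar> \<le> 2 * radius" using Y \<phi> by (simp add: x_def)
    then have "x\<^sup>2 \<le> (2 * radius)\<^sup>2" by (metis abs_ge_zero power2_abs power_mono)
    then have x2: "k\<^sup>2 * x\<^sup>2 \<le> k\<^sup>2 * (4 * radius\<^sup>2)" by (simp add: power_mult_distrib mult_left_mono)
    have "v t * (k * x - v t) \<le> k * (v t * x)"
      by (simp add: algebra_simps)
    also have "\<dots> \<le> k * (k * x\<^sup>2)"
      using vx' k_pos by simp
    also have "\<dots> = k\<^sup>2 * x\<^sup>2" by (simp add: power2_eq_square)
    finally have "c * S t < 4 * k\<^sup>2 * radius\<^sup>2"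
      using pos x2 by linarith
    then have S: "S t < 4 * k\<^sup>2 * radius\<^sup>2 / c"
      using c_pos by (simp add: field_simps)
    have "\<bar>d * y t\<bar> powr p \<le> (radius powr m) powr p" "\<bar>Y t\<bar> powr (m + 1) \<le> radius powr (m + 1)"
      using dy Y p m_gt by (auto intro!: powr_mono2)
    then have "k / d * \<bar>d * y t\<bar> powr p / p \<le> k / d * (radius powr m) powr p / p"
      "\<bar>Y t\<bar> powr (m + 1) / (m + 1) \<le> radius powr (m + 1) / (m + 1)"
      using k_pos d_gt p m_gt by (auto intro!: divide_right_mono mult_left_mono)
    moreover have "- (d * y t * Y t) \<le> radius powr m * radius"
    proof -
      have "\<bar>(d * y t) * Y t\<bar> \<le> radius powr m * radius"
        unfolding abs_mult[of "d * y t"] using dy Y by (intro mult_mono) auto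
      then show ?thesis by linarith
    qed
    moreover have "0 \<le> (d - \<alpha>) * (y t)\<^sup>2 / 2" using \<alpha> by simp
    ultimately show False
      using above S unfolding W_def lyapunov_bound_def by linarith
  qed
qed

text \<open>Since \<open>k / d = 1 + (d - n) / d\<close>, one copy of the power of \<open>y\<close>
  pays for Young's inequality, with conjugate exponents \<open>p\<close> and \<open>m + 1\<close>.
  The remainder is free of \<open>Y\<close> and can therefore act as a barrier in \<open>y\<close>
  alone.\<close>

lemma young_lower: "(d - n) / d * \<bar>d * y t\<bar> powr p / p - (d - \<alpha>) * (y t)\<^sup>2 / 2 \<le> W t"
proof -
  have "\<bar>d * y t\<bar> * \<bar>Y t\<bar> \<le> \<bar>d * y t\<bar> powr p / p + \<bar>Y t\<bar> powr (m + 1) / (m + 1)"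
    using p m_gt p_conj by (intro Youngs_inequality) auto
  moreover have "d * y t * Y t \<le> \<bar>d * y t\<bar> * \<bar>Y t\<bar>"
    by (metis abs_ge_self abs_mult)
  moreover have "(d - n) / d * \<bar>d * y t\<bar> powr p / p = k / d * \<bar>d * y t\<bar> powr p / p - \<bar>d * y t\<bar> powr p / p"
    using d_gt p by (simp add: field_simps)
  ultimately show ?thesis unfolding W_def by linarith
qed

text \<open>Backward uniqueness for the zero solution by a Gronwall estimate: on a compact time
  interval the right-hand side is bounded by a multiple of
  \<open>\<bar>y\<bar> + \<bar>Y\<bar>\<close>, so vanishing at \<open>t\<close> would propagate
  back to a time where \<open>y\<close> is nonzero.\<close>

lemma not_both_0:
  assumes "y t = 0" "Y t = 0"
  shows False
proof -
  obtain t0 where t0: "\<And>s. s \<le> t0 \<Longrightarrow> y s \<noteq> 0" using nontrivial by auto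
  define s where "s = min t t0"
  have "s \<le> t" by (simp add: s_def)
  have "bounded (y ` {s..t})"
    by (intro compact_imp_bounded compact_continuous_image continuous_y compact_Icc)
  then obtain A where A: "\<And>u. u \<in> {s..t} \<Longrightarrow> \<bar>y u\<bar> \<le> A"
    unfolding bounded_iff by (metis imageI real_norm_def)
  have "bounded (Y ` {s..t})"
    by (intro compact_imp_bounded compact_continuous_image continuous_Y compact_Icc)
  then obtain B where B: "\<And>u. u \<in> {s..t} \<Longrightarrow> \<bar>Y u\<bar> \<le> B"
    unfolding bounded_iff by (metis imageI real_norm_def)
  define H where "H = exp (- c * s) * A powr (q - 1)"
  define G where "G = B powr (m - 1)"
  \<comment> \<open>Mixed products are split by
    \<open>2 * (a * b) \<le> a\<^sup>2 + b\<^sup>2\<close>. Of the three copies of \<open>G\<close>,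
    one comes from \<open>y u * g (Y u)\<close> and two from \<open>Y u * g (Y u)\<close>.\<close>
  define K where "K = \<alpha> + H + 3 * G"
  have "0 \<le> A" "0 \<le> B" using A[of s] B[of s] \<open>s \<le> t\<close> by auto
  have "0 \<le> K" "0 \<le> H" "0 \<le> G" using \<alpha> by (auto simp: K_def H_def G_def)
  have ineq: "0 \<le> 2 * y u * v u + 2 * Y u * V u + K * ((y u)\<^sup>2 + (Y u)\<^sup>2)" if u: "u \<in> {s..t}" for u
  proof -
    define a b where "a = \<bar>y u\<bar>" and "b = \<bar>Y u\<bar>"
    have "h u \<le> H"
      unfolding h_def H_def using u A[OF u] q mult_left_mono[of s u c] c_pos
      by (intro mult_mono powr_mono2) auto
    have gY: "\<bar>g (Y u)\<bar> \<le> G * b"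
      unfolding G_def b_def by (rule abs_g_le[OF B[OF u]])
    have ab: "2 * (a * b) \<le> a\<^sup>2 + b\<^sup>2" using sum_squares_bound[of a b] by (simp add: mult.assoc)
    have "y u * g (Y u) \<le> \<bar>y u * g (Y u)\<bar>" by simp
    also have "\<dots> \<le> a * (G * b)"
      unfolding abs_mult a_def[symmetric] by (intro mult_left_mono gY) (simp add: a_def)
    finally have 1: "y u * g (Y u) \<le> G * (a * b)" by (simp add: mult_ac)
    have "Y u * g (Y u) \<le> \<bar>Y u * g (Y u)\<bar>" by simp
    also have "\<dots> \<le> b * (G * b)"
      unfolding abs_mult b_def[symmetric] by (intro mult_left_mono gY) (simp add: b_def)
    finally have 2: "Y u * g (Y u) \<le> G * b\<^sup>2" by (simp add: mult_ac power2_eq_square)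
    have "- ((\<alpha> + h u) * (y u * Y u)) \<le> \<bar>(\<alpha> + h u) * (y u * Y u)\<bar>" by simp
    also have "\<dots> \<le> (\<alpha> + H) * (a * b)"
      unfolding abs_mult a_def[symmetric] b_def[symmetric] using \<alpha> h_nonneg[of u] \<open>h u \<le> H\<close>
      by (intro mult_mono) (auto simp: a_def b_def)
    finally have 3: "- ((\<alpha> + h u) * (y u * Y u)) \<le> (\<alpha> + H) * (a * b)" .
    have sq: "(y u)\<^sup>2 = a\<^sup>2" "(Y u)\<^sup>2 = b\<^sup>2" by (auto simp: a_def b_def)
    have 4: "(\<alpha> + H) * (2 * (a * b)) \<le> (\<alpha> + H) * (a\<^sup>2 + b\<^sup>2)" "G * (2 * (a * b)) \<le> G * (a\<^sup>2 + b\<^sup>2)"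
      using ab \<alpha> \<open>0 \<le> H\<close> \<open>0 \<le> G\<close> by (auto intro!: mult_left_mono)
    have 5: "0 \<le> G * a\<^sup>2" "0 \<le> d * a\<^sup>2" "0 \<le> (d - n) * b\<^sup>2"
      using \<open>0 \<le> G\<close> d_gt n_less by auto
    have "2 * y u * v u + 2 * Y u * V u =
       2 * (d * a\<^sup>2) - 2 * (y u * g (Y u)) + 2 * ((d - n) * b\<^sup>2) + 2 * ((\<alpha> + h u) * (y u * Y u)) - 2 * (Y u * g (Y u))"
      unfolding sq[symmetric] v_def V_def by (simp add: algebra_simps power2_eq_square)
    then show ?thesis
      using 1 2 3 4 5 unfolding sq K_def by (simp add: algebra_simps)
  qed
  have "((y s)\<^sup>2 + (Y s)\<^sup>2) * exp (K * s) \<le> ((y t)\<^sup>2 + (Y t)\<^sup>2) * exp (K * t)"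
  proof (rule DERIV_nonneg_imp_nondecreasing[OF \<open>s \<le> t\<close>, where f="\<lambda>u. ((y u)\<^sup>2 + (Y u)\<^sup>2) * exp (K * u)"])
    fix u assume u: "s \<le> u" "u \<le> t"
    have D: "((\<lambda>u. ((y u)\<^sup>2 + (Y u)\<^sup>2) * exp (K * u)) has_real_derivative
      (2 * y u * v u + 2 * Y u * V u + K * ((y u)\<^sup>2 + (Y u)\<^sup>2)) * exp (K * u)) (at u)"
      by (auto intro!: derivative_eq_intros y_deriv_v Y_deriv_V simp: algebra_simps)
    show "\<exists>D. ((\<lambda>u. ((y u)\<^sup>2 + (Y u)\<^sup>2) * exp (K * u)) has_real_derivative D) (at u) \<and> 0 \<le> D"
      using ineq[of u] u by (intro exI[of _ "(2 * y u * v u + 2 * Y u * V u + K * ((y u)\<^sup>2 + (Y u)\<^sup>2)) * exp (K * u)"] conjI D mult_nonneg_nonneg) auto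
  qed
  then have "((y s)\<^sup>2 + (Y s)\<^sup>2) * exp (K * s) \<le> 0" using assms by simp
  then have "(y s)\<^sup>2 + (Y s)\<^sup>2 \<le> 0" by (simp add: mult_le_0_iff not_le[symmetric])
  then have "y s = 0" by (simp add: sum_power2_le_zero_iff)
  then show False using t0[of s] by (simp add: s_def)
qed

end

section \<open>Oscillation\<close>

context shooting
begin

lemma uminus: "shooting n p q \<alpha> (\<lambda>t. - y t) (\<lambda>t. - Y t)"
proof unfold_locales
  show "((\<lambda>t. - y t) has_real_derivative d * - y t - g (- Y t)) (at t)" for t
    using DERIV_minus[OF y_deriv[of t]] by (simp add: signed_power_minus)
  show "((\<lambda>t. - Y t) has_real_derivative
      (d - n) * - Y t + (\<alpha> + exp (- c * t) * \<bar>- y t\<bar> powr (q - 1)) * - y t - g (- Y t)) (at t)" for t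
    using DERIV_minus[OF Y_deriv[of t]] by (simp add: signed_power_minus algebra_simps)
qed (use \<alpha> y_at_bot Y_at_bot source_at_bot nontrivial tendsto_minus[OF y_at_bot] tendsto_minus[OF Y_at_bot] in auto)

lemma W_le: "W t \<le> lyapunov_bound"
  using W_S_le[of t] S_nonneg[of t] by linarith

text \<open>For bounded \<open>y\<close> the term of degree \<open>m + 1\<close> in \<open>W\<close>
  dominates the one that is linear in \<open>Y\<close>.\<close>

lemma Y_bounded:
  assumes "\<bar>y t\<bar> \<le> b"
  shows "\<bar>Y t\<bar> \<le> max 1 ((m + 1) * (lyapunov_bound + d * b + (d - \<alpha>) * b\<^sup>2 / 2))"
proof (cases "\<bar>Y t\<bar> \<le> 1")
  case False
  define A where "A = lyapunov_bound + (d - \<alpha>) * b\<^sup>2 / 2"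
  have "0 \<le> A" using lyapunov_bound_pos \<alpha> by (simp add: A_def)
  have "(y t)\<^sup>2 \<le> b\<^sup>2" using assms by (metis abs_ge_zero power2_abs power_mono)
  then have "(d - \<alpha>) * (y t)\<^sup>2 / 2 \<le> (d - \<alpha>) * b\<^sup>2 / 2"
    using \<alpha> by (intro divide_right_mono mult_left_mono) auto
  moreover have "d * y t * Y t \<le> d * b * \<bar>Y t\<bar>"
  proof -
    have "y t * Y t \<le> \<bar>y t\<bar> * \<bar>Y t\<bar>" by (metis abs_ge_self abs_mult)
    also have "\<dots> \<le> b * \<bar>Y t\<bar>" using assms by (rule mult_right_mono) simp
    finally show ?thesis using d_gt by simp
  qed
  moreover have "0 \<le> k / d * \<bar>d * y t\<bar> powr p / p" using k_pos d_gt p by simp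
  ultimately have "\<bar>Y t\<bar> powr (m + 1) / (m + 1) \<le> A + d * b * \<bar>Y t\<bar>"
    using W_le[of t] unfolding W_def A_def by linarith
  also have "\<dots> \<le> (A + d * b) * \<bar>Y t\<bar>"
    using False \<open>0 \<le> A\<close> mult_left_mono[of 1 "\<bar>Y t\<bar>" A] by (simp add: algebra_simps)
  finally have "\<bar>Y t\<bar> powr (m + 1) \<le> (m + 1) * ((A + d * b) * \<bar>Y t\<bar>)"
    using m_gt by (subst (asm) pos_divide_le_eq) (auto simp: mult.commute)
  then have "\<bar>Y t\<bar> powr m * \<bar>Y t\<bar> \<le> ((m + 1) * (A + d * b)) * \<bar>Y t\<bar>"
    by (simp only: powr_add powr_one abs_ge_zero mult.assoc)
  then have "\<bar>Y t\<bar> powr m \<le> (m + 1) * (A + d * b)"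
    by (rule mult_right_le_imp_le) (use False in auto)
  moreover have "\<bar>Y t\<bar> powr 1 \<le> \<bar>Y t\<bar> powr m"
    using False m_gt by (intro powr_mono) auto
  ultimately have "\<bar>Y t\<bar> \<le> (m + 1) * (A + d * b)" by simp
  also have "\<dots> = (m + 1) * (lyapunov_bound + d * b + (d - \<alpha>) * b\<^sup>2 / 2)"
    by (simp add: A_def algebra_simps)
  finally show ?thesis by simp
qed simp

lemma h_tendsto_0:
  assumes "\<And>t. T \<le> t \<Longrightarrow> \<bar>y t\<bar> \<le> b"
  shows "(h \<longlongrightarrow> 0) at_top"
proof (rule Lim_null_comparison)
  show "\<forall>\<^sub>F t in at_top. norm (h t) \<le> exp (- c * t) * b powr (q - 1)"
    using eventually_ge_at_top[of T]
  proof eventually_elim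
    case (elim t)
    then show ?case
      using assms[of t] q unfolding h_def by (auto intro!: mult_left_mono powr_mono2)
  qed
  have "((\<lambda>t. exp (- c * t)) \<longlongrightarrow> 0) at_top"
    by (rule exp_neg_tendsto_0[OF c_pos])
  then show "((\<lambda>t. exp (- c * t) * b powr (q - 1)) \<longlongrightarrow> 0) at_top"
    by (rule tendsto_mult_left_zero)
qed

lemma v_deriv_bounded:
  assumes "\<And>t. T \<le> t \<Longrightarrow> \<bar>y t\<bar> \<le> b" "\<And>t. T \<le> t \<Longrightarrow> \<bar>Y t\<bar> \<le> B"
  obtains K where "\<And>t. T \<le> t \<Longrightarrow> \<bar>d * v t - m * \<bar>Y t\<bar> powr (m - 1) * V t\<bar> \<le> K"
    "\<And>t. T \<le> t \<Longrightarrow> \<bar>v t\<bar> \<le> K" "0 < K"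
proof -
  define G where "G = B powr (m - 1)"
  define H where "H = exp (- c * T) * b powr (q - 1)"
  define Kv where "Kv = d * b + G * B"
  define KV where "KV = (d - n) * B + (\<alpha> + H) * b + G * B"
  have "0 \<le> b" "0 \<le> B" using assms[of T] by auto
  have "0 \<le> G" "0 \<le> H" by (auto simp: G_def H_def)
  have v: "\<bar>v t\<bar> \<le> Kv" and V: "\<bar>V t\<bar> \<le> KV" and P: "\<bar>Y t\<bar> powr (m - 1) \<le> G" if t: "T \<le> t" for t
  proof -
    show P: "\<bar>Y t\<bar> powr (m - 1) \<le> G"
      unfolding G_def using assms(2)[OF t] m_gt by (intro powr_mono2) auto
    have g: "\<bar>g (Y t)\<bar> \<le> G * B"
      using abs_g_le[OF assms(2)[OF t]] mult_left_mono[OF assms(2)[OF t] \<open>0 \<le> G\<close>] by (simp add: G_def)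
    have "\<bar>d * y t\<bar> \<le> d * b" using assms(1)[OF t] d_gt by (simp add: abs_mult)
    with g show "\<bar>v t\<bar> \<le> Kv" unfolding v_def Kv_def by linarith
    have "h t \<le> H" unfolding h_def H_def
      using t assms(1)[OF t] q c_pos mult_left_mono[OF t, of c] by (intro mult_mono powr_mono2) auto
    then have "\<bar>(\<alpha> + h t) * y t\<bar> \<le> (\<alpha> + H) * b"
      unfolding abs_mult using \<alpha> h_nonneg[of t] assms(1)[OF t] by (intro mult_mono) auto
    moreover have "\<bar>(d - n) * Y t\<bar> \<le> (d - n) * B" using assms(2)[OF t] n_less by (simp add: abs_mult)
    ultimately show "\<bar>V t\<bar> \<le> KV" using g unfolding V_def KV_def by linarith
  qed
  have "0 \<le> Kv" "0 \<le> KV" using v[of T] V[of T] by auto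
  have nonneg: "0 \<le> d * Kv" "0 \<le> m * G * KV" using \<open>0 \<le> Kv\<close> \<open>0 \<le> KV\<close> \<open>0 \<le> G\<close> d_gt p by auto
  show ?thesis
  proof (rule that)
    show "0 < d * Kv + m * G * KV + Kv + 1"
      using nonneg \<open>0 \<le> Kv\<close> by linarith
    fix t assume t: "T \<le> t"
    have "\<bar>d * v t\<bar> \<le> d * Kv" using v[OF t] d_gt by (simp add: abs_mult)
    moreover have "\<bar>m * \<bar>Y t\<bar> powr (m - 1) * V t\<bar> \<le> m * G * KV"
      unfolding abs_mult using p V[OF t] P[OF t] \<open>0 \<le> G\<close> by (intro mult_mono) auto
    ultimately show "\<bar>d * v t - m * \<bar>Y t\<bar> powr (m - 1) * V t\<bar> \<le> d * Kv + m * G * KV + Kv + 1"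
      "\<bar>v t\<bar> \<le> d * Kv + m * G * KV + Kv + 1"
      using v[OF t] \<open>0 \<le> Kv\<close> nonneg by linarith+
  qed
qed

text \<open>The hypothesis \<open>slope\<close> places \<open>b\<close> below the abscissa of the
  positive stationary point. On the curve \<open>v = 0\<close> the orbit then crosses in one
  direction only, so \<open>y\<close> is eventually monotone and its limit would have to be the
  abscissa of a stationary point in \<open>{0..b}\<close>.\<close>

lemma no_positive_tail:
  assumes bound: "\<And>t. \<bar>y t\<bar> \<le> b" and slope: "(d - \<alpha>) * b < (d - n) * \<phi> b"
    and pos: "\<And>t. T \<le> t \<Longrightarrow> 0 < y t"
  shows False
proof -
  have "0 < b" using bound[of T] pos[of T] by auto
  have bounds: "y t \<le> b" "- y t \<le> b" for t using bound[of t] by auto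
  \<comment> \<open>\<open>\<phi>\<close> is homogeneous of degree \<open>p - 1 < 1\<close>, so the
    inequality at \<open>b\<close> passes to all smaller positive arguments.\<close>
  have slope': "(d - \<alpha>) * x < (d - n) * \<phi> x" if x: "0 < x" "x \<le> b" for x
  proof -
    define s where "s = x / b"
    have s: "0 < s" "s \<le> 1" "x = s * b" using x \<open>0 < b\<close> by (auto simp: s_def)
    have "(d - \<alpha>) * x = s * ((d - \<alpha>) * b)" by (simp add: s)
    also have "\<dots> < s * ((d - n) * \<phi> b)" using slope s by simp
    also have "\<dots> \<le> s powr (p - 1) * ((d - n) * \<phi> b)"
    proof (rule mult_right_mono)
      show "s \<le> s powr (p - 1)" using powr_mono'[of "p - 1" 1 s] s p by simp
      show "0 \<le> (d - n) * \<phi> b" using n_less d_gt \<open>0 < b\<close> by (simp add: signed_power_def)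
    qed
    also have "\<dots> = (d - n) * \<phi> x"
      using signed_power_mult[of s "p - 2" "d * b"] s by (simp add: mult_ac)
    finally show ?thesis .
  qed
  obtain B where B: "\<And>t. \<bar>Y t\<bar> \<le> B" using Y_bounded[OF bound] by blast
  obtain K where K: "\<And>t. T \<le> t \<Longrightarrow> \<bar>d * v t - m * \<bar>Y t\<bar> powr (m - 1) * V t\<bar> \<le> K"
    "\<And>t. T \<le> t \<Longrightarrow> \<bar>v t\<bar> \<le> K" "0 < K"
    using v_deriv_bounded[of T b B] bound B by blast
  have decr: "d * v t - m * \<bar>Y t\<bar> powr (m - 1) * V t < 0" if "T \<le> t" "v t = 0" for t
  proof -
    have g: "g (Y t) = d * y t" using that by (simp add: v_def)
    then have Y: "Y t = \<phi> (y t)" using inv_g[of "Y t"] by simp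
    have "0 < y t" using pos that by simp
    then have "0 < Y t" using d_gt unfolding Y by (simp add: signed_power_def)
    have "0 \<le> h t * y t" using h_nonneg[of t] \<open>0 < y t\<close> by simp
    then have "0 < V t" using slope'[of "y t"] bound[of t] \<open>0 < y t\<close>
      unfolding V_def g Y[symmetric] by (simp add: algebra_simps)
    then show ?thesis using that \<open>0 < Y t\<close> p by simp
  qed
  have cont_v: "continuous_on A v" for A
    by (auto intro!: continuous_at_imp_continuous_on DERIV_isCont[OF v_deriv])
  have h0: "(h \<longlongrightarrow> 0) at_top" using h_tendsto_0[of T b] bound by blast
  have le0: "v t \<le> 0" if t0: "T \<le> t0" "v t0 < 0" "t0 \<le> t" for t0 t
  proof (rule ccontr)
    assume gt: "\<not> v t \<le> 0"
    obtain s where s: "t0 \<le> s" "s < t" "v s = 0" "\<And>u. s < u \<Longrightarrow> u \<le> t \<Longrightarrow> 0 < v u"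
      by (rule last_crossing[OF cont_v, of t0 t 0]) (use t0 gt in auto)
    from DERIV_neg_dec_right[OF v_deriv decr[of s]] s that
    obtain e where "0 < e" and e: "\<And>x. 0 < x \<Longrightarrow> x < e \<Longrightarrow> v (s + x) < v s" by auto
    define x where "x = min (e / 2) (t - s)"
    have "0 < x" "x < e" "s + x \<le> t" using \<open>0 < e\<close> s by (auto simp: x_def)
    with e[of x] s(3) s(4)[of "s + x"] show False by auto
  qed
  have v_sq: "1 / K * (v t)\<^sup>2 \<le> \<bar>v t\<bar>" if "T \<le> t" for t
  proof -
    have "\<bar>v t\<bar> * \<bar>v t\<bar> \<le> K * \<bar>v t\<bar>" by (intro mult_right_mono K that) simp
    then show ?thesis using K by (simp add: field_simps power2_eq_square)
  qed
  \<comment> \<open>The limit 0 also solves the stationarity equation, hence the additional sign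
    condition in that case: \<open>v \<le> 0\<close> keeps \<open>Y\<close> positive, and a small
    positive \<open>Y\<close> cannot decrease while \<open>y\<close> is positive.\<close>
  have limits: False if v0: "(v \<longlongrightarrow> 0) at_top" and l: "(y \<longlongrightarrow> l) at_top"
    and cases: "0 < l \<or> l = 0 \<and> (\<exists>T1\<ge>T. \<forall>t\<ge>T1. v t \<le> 0)" for l
  proof -
    have gY: "((\<lambda>t. g (Y t)) \<longlongrightarrow> d * l) at_top"
      using tendsto_diff[OF tendsto_mult[OF tendsto_const l, of d] v0] by (simp add: v_def)
    have "((\<lambda>t. signed_power (p - 2) (g (Y t))) \<longlongrightarrow> \<phi> l) at_top"
      by (rule isCont_tendsto_compose[OF _ gY]) (use p in \<open>auto intro: isCont_signed_power\<close>)
    then have Y: "(Y \<longlongrightarrow> \<phi> l) at_top" by (simp add: inv_g)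
    have "(V \<longlongrightarrow> (d - n) * \<phi> l + (\<alpha> + 0) * l - d * l) at_top"
      unfolding V_def[abs_def] by (intro tendsto_intros Y l h0 gY)
    from tendsto_deriv_at_top_imp_0[OF Y_deriv_V Y this]
    have "(d - n) * \<phi> l = (d - \<alpha>) * l" by (simp add: left_diff_distrib[of d \<alpha>])
    moreover have "l \<le> b"
      by (rule tendsto_upperbound[OF l]) (use bounds in auto)
    ultimately have "\<not> 0 < l" using slope'[of l] by auto
    with cases obtain T1 where "l = 0" "T \<le> T1" and T1: "\<And>t. T1 \<le> t \<Longrightarrow> v t \<le> 0" by auto
    have Ypos: "0 < Y t" if "T1 \<le> t" for t
    proof -
      have "0 < d * y t" using pos[of t] that \<open>T \<le> T1\<close> d_gt by simp
      also have "\<dots> \<le> g (Y t)" using T1[OF that] by (simp add: v_def)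
      finally show ?thesis by (simp add: signed_power_def zero_less_mult_iff)
    qed
    have Y0: "(Y \<longlongrightarrow> 0) at_top" using Y \<open>l = 0\<close> by (simp add: signed_power_def)
    then have "((\<lambda>t. \<bar>Y t\<bar> powr (m - 1)) \<longlongrightarrow> \<bar>0\<bar> powr (m - 1)) at_top"
      by (intro tendsto_powr' tendsto_intros) (use m_gt in auto)
    then have "\<forall>\<^sub>F t in at_top. \<bar>Y t\<bar> powr (m - 1) < d - n"
      using n_less by (intro order_tendstoD) auto
    then obtain T2 where T2: "\<And>t. T2 \<le> t \<Longrightarrow> \<bar>Y t\<bar> powr (m - 1) < d - n"
      by (auto simp: eventually_at_top_linorder)
    define T3 where "T3 = max T1 T2"
    have "Y T3 \<le> Y t" if "T3 \<le> t" for t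
    proof (rule DERIV_nonneg_imp_nondecreasing[OF that])
      fix s assume s: "T3 \<le> s" "s \<le> t"
      then have "T1 \<le> s" "T2 \<le> s" by (auto simp: T3_def)
      have "0 < y s" using pos[of s] \<open>T1 \<le> s\<close> \<open>T \<le> T1\<close> by simp
      have "g (Y s) \<le> (d - n) * Y s"
        using T2[OF \<open>T2 \<le> s\<close>] Ypos[OF \<open>T1 \<le> s\<close>] by (auto simp: signed_power_def intro!: mult_right_mono)
      moreover have "0 \<le> (\<alpha> + h s) * y s" using \<alpha> h_nonneg[of s] \<open>0 < y s\<close> by simp
      ultimately have "0 \<le> V s" unfolding V_def by linarith
      then show "\<exists>D. (Y has_real_derivative D) (at s) \<and> 0 \<le> D" using Y_deriv_V by blast
    qed
    then have "Y T3 \<le> 0"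
      by (intro tendsto_lowerbound[OF Y0]) (auto simp: eventually_at_top_linorder)
    with Ypos[of T3] show False by (simp add: T3_def)
  qed
  show False
  proof (cases "\<forall>t\<ge>T. 0 \<le> v t")
    case True
    have "(v \<longlongrightarrow> 0) at_top"
    proof (rule barbalat_square[where F=y and F'=v and T=T and B=b and K=K and c="1 / K"])
      show "1 / K * (v t)\<^sup>2 \<le> v t" if "T \<le> t" for t using v_sq[OF that] True that by simp
      show "y t \<le> b" for t using bound[of t] by simp
    qed (use K in \<open>auto intro: y_deriv_v v_deriv\<close>)
    moreover have mono: "y s \<le> y t" if "T \<le> s" "s \<le> t" for s t
      by (rule DERIV_nonneg_imp_nondecreasing[OF that(2)]) (use that True in \<open>auto intro!: exI y_deriv_v\<close>)
    obtain l where l: "(y \<longlongrightarrow> l) at_top" "\<And>t. T \<le> t \<Longrightarrow> y t \<le> l"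
      by (rule mono_bounded_tendsto_at_top[of T y b]) (use mono bounds in auto)
    moreover have "0 < l" using l(2)[of T] pos[of T] by simp
    ultimately show False using limits by blast
  next
    case False
    then obtain t0 where t0: "T \<le> t0" "v t0 < 0" by (auto simp: not_le)
    have le: "v t \<le> 0" if "t0 \<le> t" for t using le0[OF t0 that] .
    have "(v \<longlongrightarrow> 0) at_top"
    proof (rule barbalat_square[where F="\<lambda>t. - y t" and F'="\<lambda>t. - v t" and T=t0 and B=b and K=K and c="1 / K"])
      show "1 / K * (v t)\<^sup>2 \<le> - v t" if "t0 \<le> t" for t using v_sq[of t] le[OF that] t0 that by simp
      show "- y t \<le> b" for t using bound[of t] by simp
    qed (use K t0 in \<open>auto intro: y_deriv_v v_deriv DERIV_minus\<close>)
    moreover have mono: "- y s \<le> - y t" if "t0 \<le> s" "s \<le> t" for s t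
      unfolding neg_le_iff_le
      by (rule DERIV_nonpos_imp_nonincreasing[OF that(2)]) (use that le in \<open>auto intro!: exI y_deriv_v\<close>)
    obtain l where l: "((\<lambda>t. - y t) \<longlongrightarrow> l) at_top"
      by (rule mono_bounded_tendsto_at_top[of t0 "\<lambda>t. - y t" b]) (use mono bounds in auto)
    moreover have l': "(y \<longlongrightarrow> - l) at_top" using tendsto_minus[OF l] by simp
    moreover have "0 \<le> - l"
    proof (rule tendsto_lowerbound[OF l'])
      show "\<forall>\<^sub>F t in at_top. 0 \<le> y t"
        using eventually_ge_at_top[of T] by eventually_elim (use pos less_imp_le in blast)
    qed simp
    ultimately show False using limits[of "- l"] le t0 by (cases "l = 0") auto
  qed
qed

text \<open>\<open>y\<close> starts from 0 at minus infinity and would have to pass through modulus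
  \<open>b\<close>, where \<open>young_lower\<close> exceeds the universal bound on
  \<open>W\<close>.\<close>

lemma barrier_bound:
  assumes "0 < b" and barrier: "lyapunov_bound < (d - n) / d * (d * b) powr p / p - (d - \<alpha>) * b\<^sup>2 / 2"
  shows "\<bar>y t\<bar> \<le> b"
proof (rule ccontr)
  assume gt: "\<not> \<bar>y t\<bar> \<le> b"
  have "((\<lambda>t. \<bar>y t\<bar>) \<longlongrightarrow> 0) at_bot"
    using y_at_bot by (simp add: tendsto_rabs_zero_iff)
  then have "\<forall>\<^sub>F s in at_bot. \<bar>y s\<bar> < b" using \<open>0 < b\<close> by (rule order_tendstoD)
  then obtain t0 where "\<And>s. s \<le> t0 \<Longrightarrow> \<bar>y s\<bar> < b" by (auto simp: eventually_at_bot_linorder)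
  then have "\<bar>y (min t t0)\<bar> \<le> b" by (simp add: less_imp_le)
  then have "\<exists>s. min t t0 \<le> s \<and> s \<le> t \<and> \<bar>y s\<bar> = b"
    using gt continuous_on_rabs[OF continuous_y] by (intro IVT'[of "\<lambda>s. \<bar>y s\<bar>"]) (simp_all add: not_le less_imp_le)
  then obtain s where s: "\<bar>y s\<bar> = b" by blast
  then have "\<bar>d * y s\<bar> = d * b" "(y s)\<^sup>2 = b\<^sup>2" using d_gt by (auto simp: abs_mult)
  with young_lower[of s] W_le[of s] barrier show False by simp
qed

lemma oscillates:
  assumes "0 < b" and "lyapunov_bound < (d - n) / d * (d * b) powr p / p - (d - \<alpha>) * b\<^sup>2 / 2"
    and "(d - \<alpha>) * b < (d - n) * \<phi> b"
  shows "\<exists>t\<ge>T. y t = 0"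
proof (rule ccontr)
  assume "\<not> ?thesis"
  then have nz: "\<And>t. T \<le> t \<Longrightarrow> y t \<noteq> 0" by auto
  have bound: "\<bar>y t\<bar> \<le> b" for t by (rule barrier_bound) (use assms in auto)
  interpret neg: shooting n p q \<alpha> "\<lambda>t. - y t" "\<lambda>t. - Y t" by (rule uminus)
  show False
  proof (cases "0 < y T")
    case True
    have "0 < y t" if "T \<le> t" for t
      using IVT2'[of y t 0 T] nz that True continuous_y by (metis less_imp_le linorder_not_less)
    then show False using no_positive_tail[OF bound assms(3)] by blast
  next
    case False
    have "y t < 0" if "T \<le> t" for t
      using IVT'[of y T 0 t] nz that False continuous_y by (metis less_imp_le linorder_not_less)
    then show False using neg.no_positive_tail[of b T] bound assms(3) by simp
  qed
qed

end

section \<open>Orbits turning around the origin\<close>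

context shooting
begin

text \<open>Where \<open>y\<close> vanishes, \<open>W\<close> reduces to its pure \<open>Y\<close>
  term, so the universal level becomes a bound on the flux that is the same at all zeros.\<close>

lemma flux_at_zero:
  assumes "y t = 0"
  shows "\<bar>Y t\<bar> \<le> ((m + 1) * lyapunov_bound) powr (1 / (m + 1))"
proof -
  have "\<bar>Y t\<bar> powr (m + 1) / (m + 1) \<le> lyapunov_bound"
    using W_le[of t] assms by (simp add: W_def)
  then have "\<bar>Y t\<bar> powr (m + 1) \<le> (m + 1) * lyapunov_bound"
    using m_gt by (subst (asm) pos_divide_le_eq) (auto simp: mult.commute)
  then have "(\<bar>Y t\<bar> powr (m + 1)) powr (1 / (m + 1)) \<le> ((m + 1) * lyapunov_bound) powr (1 / (m + 1))"
    by (intro powr_mono2) (use m_gt in auto)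
  moreover have "(\<bar>Y t\<bar> powr (m + 1)) powr (1 / (m + 1)) = \<bar>Y t\<bar>"
  proof -
    have "(m + 1) * (1 / (m + 1)) = 1" using m_gt by simp
    then show ?thesis unfolding powr_powr by simp
  qed
  ultimately show ?thesis by simp
qed

text \<open>\<open>exp (- d * t) * y t\<close> is the original unknown at radius \<open>exp t\<close>; at its maximum on a hump
  \<open>Y\<close> vanishes, and there the monotone quantity \<open>exp ((n - d) * t) * (y t - Y t)\<close> controls it.\<close>

lemma hump_bound:
  assumes "n \<le> \<alpha>" and "y T = 0" "T \<le> t" "t \<le> u" "y u = 0"
  shows "exp (- d * t) * y t \<le> ((m + 1) * lyapunov_bound) powr (1 / (m + 1)) * exp (- d * T)"
proof (cases "0 < y t")
  case False
  then have "exp (- d * t) * y t \<le> 0" by (simp add: mult_le_0_iff)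
  also have "0 \<le> ((m + 1) * lyapunov_bound) powr (1 / (m + 1)) * exp (- d * T)" by simp
  finally show ?thesis .
next
  case True
  let ?B = "((m + 1) * lyapunov_bound) powr (1 / (m + 1))"
  let ?w = "\<lambda>t. exp (- d * t) * y t"
  have w': "(?w has_real_derivative - exp (- d * t) * g (Y t)) (at t)" for t
    by (auto intro!: derivative_eq_intros y_deriv_v simp: v_def algebra_simps)
  obtain x where x: "T < x" "x < u" "?w t \<le> ?w x" "- exp (- d * x) * g (Y x) = 0"
    using hump_max[OF w', of T u t] True assms by auto
  have "\<bar>Y x\<bar> powr m = 0" using x(4) abs_signed_power[of "m - 1" "Y x"] by simp
  then have "Y x = 0" by simp
  have "0 < ?w x" using True x(3) by (smt (verit) exp_gt_zero mult_pos_pos)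
  then have "0 < y x" by (simp add: zero_less_mult_iff)
  obtain s where s: "T \<le> s" "s < x" "y s = 0" and pos: "\<And>z. s < z \<Longrightarrow> z \<le> x \<Longrightarrow> 0 < y z"
    by (rule last_crossing[OF continuous_y, of T x 0]) (use \<open>0 < y x\<close> x assms in auto)
  have "(y x - Y x) * exp ((n - d) * x) \<le> (y s - Y s) * exp ((n - d) * s)"
  proof (rule DERIV_nonpos_imp_nonincreasing[where f="\<lambda>z. (y z - Y z) * exp ((n - d) * z)"])
    show "s \<le> x" using s by simp
    fix z assume z: "s \<le> z" "z \<le> x"
    have "0 \<le> y z" using pos[of z] s z by (cases "z = s") (auto intro: less_imp_le)
    have "((\<lambda>z. (y z - Y z) * exp ((n - d) * z)) has_real_derivative
        (v z - V z + (n - d) * (y z - Y z)) * exp ((n - d) * z)) (at z)"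
      by (auto intro!: derivative_eq_intros y_deriv_v Y_deriv_V simp: algebra_simps)
    moreover have "v z - V z + (n - d) * (y z - Y z) = (n - \<alpha> - h z) * y z"
      by (simp add: v_def V_def algebra_simps)
    moreover have "(n - \<alpha> - h z) * y z \<le> 0"
      using \<open>0 \<le> y z\<close> h_nonneg[of z] assms by (intro mult_nonpos_nonneg) auto
    ultimately show "\<exists>D. ((\<lambda>z. (y z - Y z) * exp ((n - d) * z)) has_real_derivative D) (at z) \<and> D \<le> 0"
      by (metis exp_ge_zero mult_nonpos_nonneg)
  qed
  also have "\<dots> \<le> ?B * exp ((n - d) * s)"
    using flux_at_zero[OF s(3)] s(3) by (intro mult_right_mono) auto
  finally have 1: "y x * exp ((n - d) * x) \<le> ?B * exp ((n - d) * s)" using \<open>Y x = 0\<close> by simp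
  have "?w x = y x * exp ((n - d) * x) * exp (- n * x)"
    by (simp add: mult.assoc mult.commute exp_add[symmetric] algebra_simps)
  also have "\<dots> \<le> ?B * exp ((n - d) * s) * exp (- n * x)"
    using 1 by (rule mult_right_mono) simp
  also have "\<dots> = ?B * exp ((n - d) * s - n * x)"
    by (simp add: exp_add[symmetric])
  also have "\<dots> \<le> ?B * exp (- d * T)"
  proof (intro mult_left_mono)
    have "n * s \<le> n * x" "d * T \<le> d * s" using n d_gt s by auto
    then show "exp ((n - d) * s - n * x) \<le> exp (- d * T)" by (simp add: algebra_simps)
  qed simp
  finally show ?thesis using x by simp
qed

text \<open>\<open>Z\<close> and \<open>g Z / d\<close> are the coordinates of the positive
  stationary point of the limit system with \<alpha> replaced by \<beta>. At the top of a hump of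
  \<open>y\<close> the orbit lies on \<open>v = 0\<close> with \<open>V\<close> nonnegative, and the
  part of that curve satisfying this ends at the stationary point.\<close>

lemma y_upper:
  assumes \<beta>: "\<alpha> < \<beta>" "\<beta> < d" and h: "\<And>t. T \<le> t \<Longrightarrow> h t \<le> \<beta> - \<alpha>"
    and Z: "0 < Z" "Z powr (m - 1) = d * (d - n) / (d - \<beta>)"
    and "y T = 0" "T \<le> t" "t \<le> u" "y u = 0"
  shows "y t \<le> g Z / d"
proof (cases "0 < y t")
  case False
  moreover have "0 \<le> g Z / d" using g_mono[of 0 Z] Z(1) d_gt by simp
  ultimately show ?thesis by simp
next
  case True
  obtain x where x: "T < x" "x < u" "y t \<le> y x" "v x = 0"
    and max: "\<And>z. T \<le> z \<Longrightarrow> z \<le> u \<Longrightarrow> y z \<le> y x"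
    using hump_max[OF y_deriv_v, of T u t] True assms by auto
  have "0 < y x" using True x by simp
  have gY: "g (Y x) = d * y x" using x by (simp add: v_def)
  have "0 < g (Y x)" unfolding gY using \<open>0 < y x\<close> d_gt by simp
  then have "0 < Y x" by (simp add: signed_power_def zero_less_mult_iff)
  have "0 \<le> V x"
  proof (rule ccontr)
    assume "\<not> 0 \<le> V x"
    then have "0 < d * v x - m * \<bar>Y x\<bar> powr (m - 1) * V x"
      using x \<open>0 < Y x\<close> p by (simp add: mult_pos_neg divide_neg_pos)
    from DERIV_pos_inc_right[OF v_deriv this]
    obtain e where e: "0 < e" "\<And>z. 0 < z \<Longrightarrow> z < e \<Longrightarrow> v x < v (x + z)" by auto
    define z where "z = min (e / 2) (u - x)"
    have z: "0 < z" "z < e" "x + z \<le> u" using e x by (auto simp: z_def)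
    obtain w where w: "x < w" "w < x + z" "y (x + z) - y x = (x + z - x) * v w"
      using MVT2[of x "x + z" y v] z y_deriv_v by auto
    have "0 < v w" using e(2)[of "w - x"] w z x by simp
    then have "0 < y (x + z) - y x" using w z by simp
    then show False using max[of "x + z"] z x by simp
  qed
  then have "d * y x \<le> (d - n) * Y x + (\<alpha> + h x) * y x" by (simp add: V_def gY)
  also have "\<dots> \<le> (d - n) * Y x + \<beta> * y x"
    using h[of x] x \<open>0 < y x\<close> by simp
  finally have "(d - \<beta>) * y x \<le> (d - n) * Y x" by (simp add: algebra_simps)
  then have "(d - \<beta>) * (d * y x) \<le> d * (d - n) * Y x"
    using mult_left_mono[of "(d - \<beta>) * y x" "(d - n) * Y x" d] d_gt by (simp add: mult_ac)
  then have "(d - \<beta>) * Y x powr (m - 1) * Y x \<le> d * (d - n) * Y x"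
    unfolding gY[symmetric] using \<open>0 < Y x\<close> by (simp add: signed_power_def mult.assoc)
  then have "(d - \<beta>) * Y x powr (m - 1) \<le> d * (d - n)"
    using \<open>0 < Y x\<close> by simp
  then have "Y x powr (m - 1) \<le> Z powr (m - 1)"
    using \<beta> Z by (simp add: pos_le_divide_eq mult.commute)
  then have "Y x \<le> Z"
    using powr_less_mono2[of "m - 1" Z "Y x"] Z m_gt by (auto simp: not_le[symmetric])
  then have "d * y x \<le> g Z" unfolding gY[symmetric] by (rule g_mono)
  then have "y x \<le> g Z / d" using d_gt by (simp add: pos_le_divide_eq mult.commute)
  then show ?thesis using x by linarith
qed

text \<open>At the top of a hump of \<open>Y\<close> the equation \<open>V = 0\<close>, with
  \<open>y\<close> at most the stationary abscissa, balances at \<open>Z\<close>; beyond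
  \<open>Z\<close> the superlinear \<open>g\<close> exceeds the other terms.\<close>

lemma Y_upper:
  assumes \<beta>: "\<alpha> < \<beta>" "\<beta> < d" and h: "\<And>t. T \<le> t \<Longrightarrow> h t \<le> \<beta> - \<alpha>"
    and Z: "0 < Z" "Z powr (m - 1) = d * (d - n) / (d - \<beta>)"
    and y: "\<And>t. T \<le> t \<Longrightarrow> y t \<le> g Z / d"
    and "Y T = 0" "T \<le> t" "t \<le> u" "Y u = 0"
  shows "Y t \<le> Z"
proof (cases "0 < Y t")
  case False
  then show ?thesis using Z by simp
next
  case True
  obtain x where x: "T < x" "Y t \<le> Y x" "V x = 0"
    by (rule hump_max[OF Y_deriv_V, of T u t]) (use True assms in auto)
  have "Y x \<le> Z"
  proof (rule ccontr)
    assume gt: "\<not> Y x \<le> Z"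
    have "(\<alpha> + h x) * y x \<le> \<beta> * (g Z / d)"
    proof (cases "0 \<le> y x")
      case True
      then show ?thesis using h[of x] y[of x] x \<beta> \<alpha> h_nonneg[of x] by (intro mult_mono) auto
    next
      case False
      then have "(\<alpha> + h x) * y x \<le> 0" using \<alpha> h_nonneg[of x] by (simp add: mult_le_0_iff)
      also have "0 \<le> \<beta> * (g Z / d)" using \<alpha> \<beta> g_mono[of 0 Z] Z(1) d_gt by simp
      finally show ?thesis .
    qed
    then have "g (Y x) \<le> (d - n) * Y x + \<beta> * (g Z / d)"
      using x by (simp add: V_def)
    moreover have "d - n = (d - \<beta>) * Z powr (m - 1) / d"
      using Z \<beta> d_gt by simp
    moreover have "g Z = Z powr (m - 1) * Z" using Z by (simp add: signed_power_def)
    moreover have "(d - \<beta>) * M / d * Y x + \<beta> * (M * Z / d) = M * ((d - \<beta>) * Y x + \<beta> * Z) / d" for M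
      using d_gt by (simp add: field_simps)
    ultimately have "g (Y x) \<le> Z powr (m - 1) * ((d - \<beta>) * Y x + \<beta> * Z) / d"
      by metis
    also have "\<dots> \<le> Z powr (m - 1) * (d * Y x) / d"
    proof -
      have "\<beta> * Z \<le> \<beta> * Y x" using gt \<alpha> \<beta> by simp
      then have "(d - \<beta>) * Y x + \<beta> * Z \<le> d * Y x" by (simp add: algebra_simps)
      then show ?thesis using d_gt by (intro divide_right_mono mult_left_mono) auto
    qed
    finally have "g (Y x) \<le> Z powr (m - 1) * Y x" using d_gt by simp
    moreover have "Z powr (m - 1) * Y x < Y x powr (m - 1) * Y x"
      using gt Z m_gt by (intro mult_strict_right_mono powr_less_mono2) auto
    ultimately show False using gt Z by (simp add: signed_power_def)
  qed
  then show ?thesis using x by simp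
qed

text \<open>Since \<open>g\<close> is superlinear, the linear part governs small orbits. It is
  triangular with positive diagonal \<open>d\<close> and \<open>d - n\<close>, so a weighted square
  norm with a large enough weight on \<open>y\<close> is nondecreasing and cannot tend to 0.\<close>

lemma source_near_origin:
  assumes h: "\<And>t. T \<le> t \<Longrightarrow> \<alpha> + h t \<le> d" and y: "(y \<longlongrightarrow> 0) at_top" and Y: "(Y \<longlongrightarrow> 0) at_top"
  shows False
proof -
  define e where "e = d - n"
  define C where "C = 1 + d"
  \<comment> \<open>This weight makes the discriminant of
    \<open>2 * A * d * a\<^sup>2 - 2 * C * (a * b) + e * b\<^sup>2\<close> vanish. In
    \<open>C = 1 + d\<close> the \<open>d\<close> covers the coupling and the 1 covers
    \<open>g\<close>, because \<eta> is at most \<open>1 / A\<close>.\<close>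
  define A where "A = C\<^sup>2 / (2 * d * e)"
  define \<eta> where "\<eta> = min (1 / A) (e / 2)"
  have "0 < e" "0 < C" using n_less d_gt by (auto simp: e_def C_def)
  then have "0 < A" using d_gt by (simp add: A_def)
  then have "0 < \<eta>" using \<open>0 < e\<close> by (simp add: \<eta>_def)
  have A: "2 * A * d * e = C\<^sup>2" using \<open>0 < e\<close> d_gt by (simp add: A_def)
  have "((\<lambda>t. \<bar>Y t\<bar> powr (m - 1)) \<longlongrightarrow> \<bar>0\<bar> powr (m - 1)) at_top"
    by (intro tendsto_powr' tendsto_intros Y) (use m_gt in auto)
  then have "\<forall>\<^sub>F t in at_top. \<bar>Y t\<bar> powr (m - 1) < \<eta>"
    using \<open>0 < \<eta>\<close> by (intro order_tendstoD) auto
  then obtain T1 where T1: "\<And>t. T1 \<le> t \<Longrightarrow> \<bar>Y t\<bar> powr (m - 1) < \<eta>"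
    by (auto simp: eventually_at_top_linorder)
  define T2 where "T2 = max T T1"
  define Q where "Q t = A * (y t)\<^sup>2 + (Y t)\<^sup>2" for t
  have ineq: "0 \<le> A * (2 * y t * v t) + 2 * Y t * V t" if "T2 \<le> t" for t
  proof -
    have t: "T \<le> t" "T1 \<le> t" using that by (auto simp: T2_def)
    define a b where "a = \<bar>y t\<bar>" and "b = \<bar>Y t\<bar>"
    have "0 \<le> a" "0 \<le> b" by (auto simp: a_def b_def)
    have gY: "\<bar>g (Y t)\<bar> \<le> \<eta> * b"
      using T1[OF t(2)] by (auto simp: signed_power_def abs_mult b_def intro!: mult_right_mono)
    have "y t * g (Y t) \<le> \<bar>y t * g (Y t)\<bar>" by simp
    also have "\<dots> \<le> a * (\<eta> * b)"
      unfolding abs_mult a_def[symmetric] by (intro mult_left_mono gY \<open>0 \<le> a\<close>)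
    finally have 1: "A * (y t * g (Y t)) \<le> A * \<eta> * (a * b)"
      using \<open>0 < A\<close> by (simp add: mult_ac)
    have "Y t * g (Y t) \<le> \<bar>Y t * g (Y t)\<bar>" by simp
    also have "\<dots> \<le> b * (\<eta> * b)"
      unfolding abs_mult b_def[symmetric] by (intro mult_left_mono gY \<open>0 \<le> b\<close>)
    finally have 2: "Y t * g (Y t) \<le> \<eta> * b\<^sup>2" by (simp add: mult_ac power2_eq_square)
    have "- ((\<alpha> + h t) * (y t * Y t)) \<le> \<bar>(\<alpha> + h t) * (y t * Y t)\<bar>" by simp
    also have "\<dots> \<le> d * (a * b)"
      unfolding abs_mult a_def[symmetric] b_def[symmetric] using h[OF t(1)] \<alpha> h_nonneg[of t] \<open>0 \<le> a\<close> \<open>0 \<le> b\<close>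
      by (intro mult_mono) auto
    finally have 3: "- ((\<alpha> + h t) * (y t * Y t)) \<le> d * (a * b)" .
    have "A * \<eta> \<le> 1" "\<eta> \<le> e / 2"
      using \<open>0 < A\<close> mult_left_mono[of \<eta> "1 / A" A] by (auto simp: \<eta>_def)
    then have 4: "A * \<eta> * (a * b) \<le> 1 * (a * b)" "\<eta> * b\<^sup>2 \<le> e / 2 * b\<^sup>2"
      using \<open>0 \<le> a\<close> \<open>0 \<le> b\<close> by (intro mult_right_mono; simp)+
    have sq: "(y t)\<^sup>2 = a\<^sup>2" "(Y t)\<^sup>2 = b\<^sup>2" by (auto simp: a_def b_def)
    have "0 \<le> (C * a - e * b)\<^sup>2" by simp
    also have "\<dots> = e * (2 * A * d * a\<^sup>2 - 2 * C * (a * b) + e * b\<^sup>2)"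
    proof -
      have "(C * a - e * b)\<^sup>2 = C\<^sup>2 * a\<^sup>2 - 2 * C * e * (a * b) + e\<^sup>2 * b\<^sup>2"
        by (simp add: power2_diff power_mult_distrib)
      then show ?thesis unfolding A[symmetric] by (simp add: algebra_simps power2_eq_square)
    qed
    finally have "0 \<le> 2 * A * d * a\<^sup>2 - 2 * C * (a * b) + e * b\<^sup>2"
      using \<open>0 < e\<close> by (simp add: zero_le_mult_iff)
    moreover have "2 * C * (a * b) = 2 * (a * b) + 2 * (d * (a * b))"
      by (simp add: C_def algebra_simps)
    moreover have "A * (2 * y t * v t) + 2 * Y t * V t = 2 * A * d * a\<^sup>2 - 2 * (A * (y t * g (Y t)))
        + 2 * (e * b\<^sup>2) + 2 * ((\<alpha> + h t) * (y t * Y t)) - 2 * (Y t * g (Y t))"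
      unfolding sq[symmetric] v_def V_def e_def by (simp add: algebra_simps power2_eq_square)
    ultimately show ?thesis using 1 2 3 4 by linarith
  qed
  have "Q T2 \<le> Q t" if "T2 \<le> t" for t
  proof (rule DERIV_nonneg_imp_nondecreasing[OF that])
    fix s assume s: "T2 \<le> s" "s \<le> t"
    have "(Q has_real_derivative A * (2 * y s * v s) + 2 * Y s * V s) (at s)"
      unfolding Q_def[abs_def] by (auto intro!: derivative_eq_intros y_deriv_v Y_deriv_V)
    with ineq s show "\<exists>D. (Q has_real_derivative D) (at s) \<and> 0 \<le> D" by blast
  qed
  moreover have "(Q \<longlongrightarrow> A * 0\<^sup>2 + 0\<^sup>2) at_top"
    unfolding Q_def[abs_def] by (intro tendsto_intros y Y)
  ultimately have "Q T2 \<le> 0"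
    by (intro tendsto_lowerbound[of Q]) (auto intro!: eventually_at_top_linorderI[of T2])
  moreover have "0 \<le> A * (y T2)\<^sup>2" "0 \<le> (Y T2)\<^sup>2" using \<open>0 < A\<close> by auto
  ultimately have "A * (y T2)\<^sup>2 = 0" "(Y T2)\<^sup>2 = 0" unfolding Q_def by linarith+
  then show False using not_both_0[of T2] \<open>0 < A\<close> by simp
qed

text \<open>Inside the box the mean slope of \<open>g\<close> is at most
  \<open>m * Z powr (m - 1)\<close>, hence below \<open>k\<close>, and \<open>W\<close> increases up
  to the source correction. Barbalat's argument gives \<open>v \<rightarrow> 0\<close>; the
  recurring zeros of \<open>y\<close> identify the limit of \<open>W\<close> as 0, and coercivity of
  \<open>W\<close> in \<open>y\<close> brings the orbit to the origin.\<close>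

lemma no_bounded_rotation:
  assumes \<beta>: "\<alpha> < \<beta>" "\<beta> < d" "p / 2 * (d - \<alpha>) < d - \<beta>"
    and h: "\<And>t. T \<le> t \<Longrightarrow> h t \<le> \<beta> - \<alpha>"
    and Z: "0 < Z" "Z powr (m - 1) = d * (d - n) / (d - \<beta>)" and contr: "m * Z powr (m - 1) < k"
    and y: "\<And>t. T \<le> t \<Longrightarrow> \<bar>y t\<bar> \<le> g Z / d" and Y: "\<And>t. T \<le> t \<Longrightarrow> \<bar>Y t\<bar> \<le> Z"
    and zeros: "\<And>s. \<exists>t\<ge>s. y t = 0"
  shows False
proof -
  define b where "b = g Z / d"
  define G where "G = m * Z powr (m - 1)"
  define Ks where "Ks = b powr (q + 1) / (q + 1)"
  \<comment> \<open>\<open>Ks * exp (- c * t)\<close> majorizes \<open>S\<close> in the box, so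
    subtracting it compensates the loss \<open>- c * S t\<close> in the derivative.\<close>
  define F where "F t = W t + S t - Ks * exp (- c * t)" for t
  have "0 < Z powr (m - 1)" using Z(1) by simp
  then have "0 < G" using p unfolding G_def by simp
  have gZ: "g Z = Z powr m" using Z powr_add[of Z "m - 1" 1] by (simp add: signed_power_def)
  have "0 < b" using Z d_gt by (simp add: b_def gZ)
  have dy: "\<bar>d * y t\<bar> \<le> Z powr m" if "T \<le> t" for t
    using y[OF that] d_gt by (simp add: gZ abs_mult pos_le_divide_eq mult.commute)
  have \<phi>: "\<bar>\<phi> (y t)\<bar> \<le> Z" if "T \<le> t" for t
  proof -
    have "\<bar>\<phi> (y t)\<bar> \<le> (Z powr m) powr (p - 1)"
      using dy[OF that] p by (auto simp: abs_signed_power intro!: powr_mono2)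
    also have "\<dots> = Z" using Z p by (simp add: powr_powr)
    finally show ?thesis .
  qed
  have S_le: "S t \<le> Ks * exp (- c * t)" if "T \<le> t" for t
    unfolding S_def Ks_def using y[OF that] q
    by (auto simp: b_def intro!: divide_right_mono mult_right_mono powr_mono2)
  have E: "((\<lambda>t. exp (- c * t)) \<longlongrightarrow> 0) at_top"
    by (rule exp_neg_tendsto_0[OF c_pos])
  have KsE: "((\<lambda>t. Ks * exp (- c * t)) \<longlongrightarrow> 0) at_top"
    using tendsto_mult_right_zero[OF E] .
  have S0: "(S \<longlongrightarrow> 0) at_top"
    by (rule Lim_null_comparison[OF _ KsE])
      (use S_le S_nonneg in \<open>auto simp: eventually_at_top_linorder\<close>)
  have F': "(F has_real_derivative v t * (k * (\<phi> (y t) - Y t) - v t) - c * S t + c * (Ks * exp (- c * t))) (at t)" for t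
  proof -
    have "((\<lambda>t. Ks * exp (- c * t)) has_real_derivative - (c * (Ks * exp (- c * t)))) (at t)"
      by (auto intro!: derivative_eq_intros)
    from DERIV_diff[OF W_S_deriv this] show ?thesis by (simp add: F_def[abs_def])
  qed
  have F'_ge: "(k / G - 1) * (v t)\<^sup>2 \<le> v t * (k * (\<phi> (y t) - Y t) - v t) - c * S t + c * (Ks * exp (- c * t))"
    if "T \<le> t" for t
  proof -
    obtain H where H: "g (\<phi> (y t)) - g (Y t) = H * (\<phi> (y t) - Y t)" "0 \<le> H"
      "\<And>Z. \<bar>Y t\<bar> \<le> Z \<Longrightarrow> \<bar>\<phi> (y t)\<bar> \<le> Z \<Longrightarrow> H \<le> m * Z powr (m - 1)"
      using g_increment by blast
    have "H \<le> G" unfolding G_def using H(3) Y[OF that] \<phi>[OF that] by blast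
    define x where "x = \<phi> (y t) - Y t"
    have v: "v t = H * x" using H(1) by (simp add: v_def g_\<phi> x_def)
    \<comment> \<open>With \<open>H \<le> G\<close> one has
      \<open>k * H \<ge> k / G * H\<^sup>2\<close>; this expresses the growth rate as a multiple of
      \<open>(v t)\<^sup>2\<close>, as Barbalat's argument requires.\<close>
    have "(k / G - 1) * H\<^sup>2 * x\<^sup>2 \<le> H * (k - H) * x\<^sup>2"
    proof (rule mult_right_mono)
      have "k / G * (H * H) \<le> k / G * (G * H)"
        using \<open>H \<le> G\<close> H(2) k_pos \<open>0 < G\<close> by (intro mult_left_mono mult_right_mono) auto
      moreover have "a / G * (G * H) = a * H" "(a / G - 1) * H\<^sup>2 = a / G * (H * H) - H * H"
        "H * (a - H) = a * H - H * H" for a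
        using \<open>0 < G\<close> by (simp_all add: algebra_simps power2_eq_square)
      ultimately show "(k / G - 1) * H\<^sup>2 \<le> H * (k - H)"
        by (metis diff_right_mono)
    qed simp
    then have "(k / G - 1) * (v t)\<^sup>2 \<le> v t * (k * x - v t)"
      by (simp add: v algebra_simps power2_eq_square)
    moreover have "c * S t \<le> c * (Ks * exp (- c * t))"
      using S_le[OF that] c_pos by (intro mult_left_mono) auto
    ultimately show ?thesis by (simp add: x_def)
  qed
  have "0 < k / G - 1" using contr[folded G_def] \<open>0 < G\<close> by (simp add: pos_less_divide_eq)
  have F_le: "F t \<le> lyapunov_bound" for t
  proof -
    have "0 \<le> Ks * exp (- c * t)" using q by (simp add: Ks_def)
    then show ?thesis using W_S_le[of t] by (simp add: F_def)
  qed
  have v0: "(v \<longlongrightarrow> 0) at_top"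
  proof -
    obtain K where K: "\<And>t. T \<le> t \<Longrightarrow> \<bar>d * v t - m * \<bar>Y t\<bar> powr (m - 1) * V t\<bar> \<le> K"
      "\<And>t. T \<le> t \<Longrightarrow> \<bar>v t\<bar> \<le> K" "0 < K"
      by (rule v_deriv_bounded[of T "g Z / d" Z]) (use y Y in auto)
    show ?thesis
      by (rule barbalat_square[OF F' F'_ge \<open>0 < k / G - 1\<close> F_le v_deriv K(1)])
  qed
  have mono: "F s \<le> F t" if st: "T \<le> s" "s \<le> t" for s t
  proof (rule DERIV_nonneg_imp_nondecreasing[OF st(2)])
    fix u assume "s \<le> u" "u \<le> t"
    have "0 \<le> (k / G - 1) * (v u)\<^sup>2" using \<open>0 < k / G - 1\<close> by simp
    then have "0 \<le> v u * (k * (\<phi> (y u) - Y u) - v u) - c * S u + c * (Ks * exp (- c * u))"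
      using F'_ge[of u] \<open>s \<le> u\<close> st by linarith
    then show "\<exists>D. (F has_real_derivative D) (at u) \<and> 0 \<le> D"
      using F'[of u] by blast
  qed
  obtain l where l: "(F \<longlongrightarrow> l) at_top"
    by (rule mono_bounded_tendsto_at_top[of T F lyapunov_bound]) (use mono F_le in auto)
  \<comment> \<open>This is the value of \<open>F\<close> at zeros of \<open>y\<close>, written in
    terms of \<open>v\<close>: there \<open>v t = - g (Y t)\<close>, so
    \<open>\<bar>Y t\<bar> = \<bar>v t\<bar> powr (p - 1)\<close>.\<close>
  define f where "f t = (\<bar>v t\<bar> powr (p - 1)) powr (m + 1) / (m + 1) - Ks * exp (- c * t)" for t
  have "(f \<longlongrightarrow> (\<bar>0\<bar> powr (p - 1)) powr (m + 1) / (m + 1) - 0) at_top"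
    unfolding f_def[abs_def]
    by (intro tendsto_diff KsE tendsto_divide tendsto_powr' tendsto_intros v0) (use p in \<open>auto simp: field_simps\<close>)
  then have f0: "(f \<longlongrightarrow> 0) at_top" using p by simp
  have "l = 0"
  proof (rule ccontr)
    assume "l \<noteq> 0"
    have "((\<lambda>t. F t - f t) \<longlongrightarrow> l - 0) at_top" by (intro tendsto_diff l f0)
    then have "\<forall>\<^sub>F t in at_top. F t - f t \<noteq> 0"
      using \<open>l \<noteq> 0\<close> by (intro tendsto_imp_eventually_ne) auto
    then obtain s where s: "\<And>t. s \<le> t \<Longrightarrow> F t - f t \<noteq> 0"
      by (auto simp: eventually_at_top_linorder)
    obtain t where t: "s \<le> t" "y t = 0" using zeros by blast
    then have "\<bar>v t\<bar> = \<bar>g (Y t)\<bar>" by (simp add: v_def)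
    then have "\<bar>v t\<bar> powr (p - 1) = \<bar>Y t\<bar>"
      using abs_signed_power[of "p - 2" "g (Y t)"] by (simp add: inv_g)
    then have "F t = f t" using t by (simp add: F_def f_def W_def S_def)
    with s t show False by auto
  qed
  have "((\<lambda>t. F t - S t + Ks * exp (- c * t)) \<longlongrightarrow> l - 0 + 0) at_top"
    by (intro tendsto_intros l S0 KsE)
  then have W0: "(W \<longlongrightarrow> 0) at_top" using \<open>l = 0\<close> by (simp add: F_def)
  \<comment> \<open>What remains of the barrier term after the quadratic term of \<open>W\<close> is
    absorbed in the box; the third condition on \<beta> makes it positive.\<close>
  define r where "r = (d - n) / d * (1 / p - (d - \<alpha>) / (2 * (d - \<beta>)))"
  have "(d - \<alpha>) / (2 * (d - \<beta>)) < 1 / p"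
    using \<beta> p by (simp add: field_simps)
  then have "0 < r" using n_less d_gt by (simp add: r_def)
  have W_ge: "r * \<bar>d * y t\<bar> powr p \<le> W t" if "T \<le> t" for t
  proof -
    \<comment> \<open>The surplus power \<open>2 - p\<close> is estimated by the size of the box,
      and \<open>m * (2 - p) = m - 1\<close> turns it into the defining value of
      \<open>Z\<close>.\<close>
    have "\<bar>d * y t\<bar>\<^sup>2 \<le> \<bar>d * y t\<bar> powr p * (d * (d - n) / (d - \<beta>))"
    proof (cases "y t = 0")
      case False
      then have pos: "0 < \<bar>d * y t\<bar>" using d_gt by simp
      have "\<bar>d * y t\<bar>\<^sup>2 = \<bar>d * y t\<bar> powr 2" using pos by (simp add: powr_numeral)
      also have "\<dots> = \<bar>d * y t\<bar> powr p * \<bar>d * y t\<bar> powr (2 - p)"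
        by (simp add: powr_add[symmetric])
      also have "\<dots> \<le> \<bar>d * y t\<bar> powr p * (Z powr m) powr (2 - p)"
        using dy[OF that] p by (intro mult_left_mono powr_mono2) auto
      also have "(Z powr m) powr (2 - p) = Z powr (m - 1)"
        using p unfolding powr_powr by (intro arg_cong2[where f="(powr)"]) (auto simp: field_simps)
      finally show ?thesis using Z by simp
    qed simp
    then have "d\<^sup>2 * (y t)\<^sup>2 \<le> \<bar>d * y t\<bar> powr p * (d * (d - n) / (d - \<beta>))"
      by (simp add: power_mult_distrib)
    then have "(d - \<alpha>) / (2 * d\<^sup>2) * (d\<^sup>2 * (y t)\<^sup>2) \<le> (d - \<alpha>) / (2 * d\<^sup>2) * (\<bar>d * y t\<bar> powr p * (d * (d - n) / (d - \<beta>)))"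
      using \<alpha> by (intro mult_left_mono) auto
    then have "(d - \<alpha>) * (y t)\<^sup>2 / 2 \<le> (d - n) / d * ((d - \<alpha>) / (2 * (d - \<beta>))) * \<bar>d * y t\<bar> powr p"
      using d_gt by (simp add: power2_eq_square mult_ac)
    moreover have "r * \<bar>d * y t\<bar> powr p = (d - n) / d * \<bar>d * y t\<bar> powr p / p
        - (d - n) / d * ((d - \<alpha>) / (2 * (d - \<beta>))) * \<bar>d * y t\<bar> powr p"
      unfolding r_def by (simp add: right_diff_distrib left_diff_distrib)
    ultimately show ?thesis using young_lower[of t] by linarith
  qed
  have "((\<lambda>t. \<bar>d * y t\<bar> powr p) \<longlongrightarrow> 0) at_top"
  proof (rule Lim_null_comparison)
    show "\<forall>\<^sub>F t in at_top. norm (\<bar>d * y t\<bar> powr p) \<le> W t / r"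
      using eventually_ge_at_top[of T]
      by eventually_elim (use W_ge \<open>0 < r\<close> in \<open>simp add: pos_le_divide_eq mult.commute\<close>)
    show "((\<lambda>t. W t / r) \<longlongrightarrow> 0) at_top" using tendsto_divide_zero[OF W0] .
  qed
  then have "((\<lambda>t. (\<bar>d * y t\<bar> powr p) powr (1 / p)) \<longlongrightarrow> 0 powr (1 / p)) at_top"
    by (intro tendsto_powr' tendsto_const) (use p in auto)
  moreover have "(\<bar>d * y t\<bar> powr p) powr (1 / p) = \<bar>d * y t\<bar>" for t
    using p by (simp add: powr_powr)
  ultimately have dy0: "((\<lambda>t. d * y t) \<longlongrightarrow> 0) at_top"
    using p by (simp add: tendsto_rabs_zero_iff)
  have y0: "(y \<longlongrightarrow> 0) at_top"
    using tendsto_divide[OF dy0 tendsto_const, of d] d_gt by simp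
  have "((\<lambda>t. g (Y t)) \<longlongrightarrow> 0) at_top"
    using tendsto_diff[OF dy0 v0] by (simp add: v_def)
  then have "((\<lambda>t. signed_power (p - 2) (g (Y t))) \<longlongrightarrow> signed_power (p - 2) 0) at_top"
    by (rule isCont_tendsto_compose[rotated]) (use p in \<open>auto intro: isCont_signed_power\<close>)
  then have "(Y \<longlongrightarrow> 0) at_top" unfolding inv_g by (simp add: signed_power_def)
  moreover have "\<alpha> + h t \<le> d" if "T \<le> t" for t using h[OF that] \<beta> by simp
  ultimately show False using source_near_origin[of T] y0 by blast
qed

text \<open>The hypothesis \<open>contr\<close> says that the trace at the nonzero stationary points
  of the limit system is positive. Being strict, it survives replacing \<alpha> by a slightly larger
  \<beta>, and the gap leaves room for the source.\<close>

lemma zeros_bounded: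
  assumes "n \<le> \<alpha>" and contr: "m * (d * (d - n) / (d - \<alpha>)) < k"
  shows "\<exists>s. \<forall>t\<ge>s. y t \<noteq> 0"
proof (rule ccontr)
  assume "\<not> (\<exists>s. \<forall>t\<ge>s. y t \<noteq> 0)"
  then have zeros: "\<And>s. \<exists>t\<ge>s. y t = 0" by auto
  interpret neg: shooting n p q \<alpha> "\<lambda>t. - y t" "\<lambda>t. - Y t" by (rule uminus)
  have neg_h: "neg.h = h" by (simp add: fun_eq_iff h_def neg.h_def)
  \<comment> \<open>At \<beta> = \<alpha> the last two conditions hold strictly, the first of them
    because \<open>p < 2\<close>; density supplies a larger \<beta>.\<close>
  obtain \<beta> where \<beta>: "\<alpha> < \<beta>" "\<beta> < d" "p / 2 * (d - \<alpha>) < d - \<beta>" "m * (d * (d - n) / (d - \<beta>)) < k"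
  proof -
    have swap: "a * (b / e) < f \<longleftrightarrow> a * b / f < e" if "0 < e" "0 < f" for a b e f :: real
      using that by (simp add: field_simps)
    have "m * (d * (d - n)) / k < d - \<alpha>"
      using contr \<alpha> k_pos by (subst (asm) swap) auto
    moreover have "p / 2 * (d - \<alpha>) < d - \<alpha>"
      using \<alpha> p mult_strict_right_mono[of "p / 2" 1 "d - \<alpha>"] by simp
    ultimately obtain e where e: "max (max 0 (p / 2 * (d - \<alpha>))) (m * (d * (d - n)) / k) < e" "e < d - \<alpha>"
      using dense[of "max (max 0 (p / 2 * (d - \<alpha>))) (m * (d * (d - n)) / k)" "d - \<alpha>"] \<alpha> by auto
    then have "m * (d * (d - n)) / k < e" "0 < e" by auto
    then have "m * (d * (d - n) / e) < k" using k_pos by (subst swap) auto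
    with e show ?thesis by (intro that[of "d - e"]) auto
  qed
  define Z where "Z = (d * (d - n) / (d - \<beta>)) powr (1 / (m - 1))"
  have Z: "0 < Z" "Z powr (m - 1) = d * (d - n) / (d - \<beta>)"
    using \<beta> n_less d_gt p by (auto simp: Z_def powr_powr)
  define B where "B = ((m + 1) * lyapunov_bound) powr (1 / (m + 1))"
  \<comment> \<open>\<open>h\<close> is the power \<open>q - 1\<close> of the modulus of the radial
    unknown, which \<open>hump_bound\<close> controls beyond a zero at time \<open>T\<close> by
    \<open>B * exp (- d * T)\<close>. A late zero thus makes \<open>h\<close> as small as desired
    without any prior bound on \<open>y\<close>.\<close>
  have "((\<lambda>t. (B * exp (- d * t)) powr (q - 1)) \<longlongrightarrow> (B * 0) powr (q - 1)) at_top"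
  proof (intro tendsto_powr' tendsto_mult tendsto_const)
    show "((\<lambda>t. exp (- d * t)) \<longlongrightarrow> 0) at_top"
      by (rule exp_neg_tendsto_0) (use d_gt in simp)
  qed (use q in \<open>auto simp: B_def\<close>)
  then have "\<forall>\<^sub>F t in at_top. (B * exp (- d * t)) powr (q - 1) < \<beta> - \<alpha>"
    using \<beta> q by (intro order_tendstoD) auto
  then obtain T0 where T0: "\<And>t. T0 \<le> t \<Longrightarrow> (B * exp (- d * t)) powr (q - 1) < \<beta> - \<alpha>"
    by (auto simp: eventually_at_top_linorder)
  obtain T where T: "T0 \<le> T" "y T = 0" using zeros by blast
  have h: "h t \<le> \<beta> - \<alpha>" if "T \<le> t" for t
  proof -
    obtain u where u: "t \<le> u" "y u = 0" using zeros by blast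
    have "exp (- d * t) * y t \<le> B * exp (- d * T)" "exp (- d * t) * - y t \<le> B * exp (- d * T)"
      using hump_bound[of T t u] neg.hump_bound[of T t u] assms(1) T u that by (auto simp: B_def)
    then have "exp (- d * t) * \<bar>y t\<bar> \<le> B * exp (- d * T)" by (auto simp: abs_if)
    then have "(exp (- d * t) * \<bar>y t\<bar>) powr (q - 1) \<le> (B * exp (- d * T)) powr (q - 1)"
      using q by (intro powr_mono2) auto
    moreover have "(exp (- d * t) * \<bar>y t\<bar>) powr (q - 1) = h t"
      by (simp add: h_def powr_mult exp_powr_real mult_ac)
    ultimately show ?thesis using T0[OF T(1)] by simp
  qed
  have y: "\<bar>y t\<bar> \<le> g Z / d" if "T \<le> t" for t
  proof -
    obtain u where u: "t \<le> u" "y u = 0" using zeros by blast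
    have "y t \<le> g Z / d" "- y t \<le> g Z / d"
      using y_upper[OF \<beta>(1,2) h Z, of T t u] neg.y_upper[OF \<beta>(1,2) _ Z, of T t u] T u that h
      by (auto simp: neg_h)
    then show ?thesis by simp
  qed
  \<comment> \<open>Rolle's theorem for the radial unknown between two zeros.\<close>
  have Y_zeros: "\<exists>t\<ge>s. Y t = 0" for s
  proof -
    obtain s1 where s1: "s \<le> s1" "y s1 = 0" using zeros by blast
    obtain s2 where s2: "s1 + 1 \<le> s2" "y s2 = 0" using zeros by blast
    have w': "((\<lambda>t. exp (- d * t) * y t) has_real_derivative - exp (- d * t) * g (Y t)) (at t)" for t
      by (auto intro!: derivative_eq_intros y_deriv_v simp: v_def algebra_simps)
    obtain x where x: "s1 < x" "x < s2" "0 = - exp (- d * x) * g (Y x)"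
      using MVT2[OF _ w', of s1 s2] s1 s2 by auto
    then have "\<bar>Y x\<bar> powr m = 0" using abs_signed_power[of "m - 1" "Y x"] by simp
    with x s1 show ?thesis by (intro exI[of _ x]) auto
  qed
  obtain T1 where T1: "T \<le> T1" "Y T1 = 0" using Y_zeros by blast
  have Y: "\<bar>Y t\<bar> \<le> Z" if "T1 \<le> t" for t
  proof -
    obtain u where u: "t \<le> u" "Y u = 0" using Y_zeros by blast
    have "h s \<le> \<beta> - \<alpha>" "\<bar>y s\<bar> \<le> g Z / d" if "T1 \<le> s" for s using that T1 h y by auto
    then have "Y t \<le> Z" "- Y t \<le> Z"
      using Y_upper[OF \<beta>(1,2) _ Z, of T1 t u] neg.Y_upper[OF \<beta>(1,2) _ Z, of T1 t u] T1 u that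
      by (auto simp: neg_h abs_le_iff)
    then show ?thesis by simp
  qed
  show False
    by (rule no_bounded_rotation[OF \<beta>(1-3) _ Z _ _ Y zeros, of T1]) (use h y T1 \<beta> Z in auto)
qed

end

section \<open>Back to the radial equation\<close>

text \<open>\<open>b\<close> is chosen so that the barrier at \<alpha> = \<open>d\<close> exceeds
  the universal level by 1. This is possible independently of \<alpha>, and both conditions then
  persist for \<alpha> near \<open>d\<close>.\<close>

lemma (in fast_diffusion) exists_threshold:
  assumes "x < d"
  obtains \<alpha>bar b where "x < \<alpha>bar" "\<alpha>bar < d" "0 < b"
    "\<And>\<alpha>. \<alpha>bar < \<alpha> \<Longrightarrow> lyapunov_bound < (d - n) / d * (d * b) powr p / p - (d - \<alpha>) * b\<^sup>2 / 2"
    "\<And>\<alpha>. \<alpha>bar < \<alpha> \<Longrightarrow> (d - \<alpha>) * b < (d - n) * \<phi> b"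
proof -
  define A where "A = (lyapunov_bound + 1) * p * d / (d - n)"
  define b where "b = A powr (1 / p) / d"
  have "0 < A" using lyapunov_bound_pos p d_gt n_less by (simp add: A_def)
  then have "0 < b" using d_gt by (simp add: b_def)
  have "(d * b) powr p = A" using \<open>0 < A\<close> d_gt p by (simp add: b_def powr_powr)
  then have B: "(d - n) / d * (d * b) powr p / p = lyapunov_bound + 1"
    using d_gt p n_less by (simp add: A_def)
  \<comment> \<open>The first entry keeps the quadratic loss below 1/2, within the margin of 1; the
    second is the slope condition solved for \<open>d - \<alpha>\<close>.\<close>
  define e where "e = min (1 / b\<^sup>2) ((d - n) * \<phi> b / b)"
  have "0 < \<phi> b" using \<open>0 < b\<close> d_gt by (simp add: signed_power_def)
  then have "0 < e" using \<open>0 < b\<close> n_less by (simp add: e_def)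
  obtain \<alpha>bar where \<alpha>bar: "max x (d - e) < \<alpha>bar" "\<alpha>bar < d"
    using dense[of "max x (d - e)" d] assms \<open>0 < e\<close> by auto
  show ?thesis
  proof (rule that[of \<alpha>bar b])
    fix \<alpha> assume "\<alpha>bar < \<alpha>"
    then have "d - \<alpha> < e" using \<alpha>bar by simp
    then have 1: "d - \<alpha> < 1 / b\<^sup>2" and 2: "d - \<alpha> < (d - n) * \<phi> b / b" by (auto simp: e_def)
    show "(d - \<alpha>) * b < (d - n) * \<phi> b"
      using 2 \<open>0 < b\<close> by (simp add: pos_less_divide_eq)
    have "(d - \<alpha>) * b\<^sup>2 < 1" using 1 \<open>0 < b\<close> by (simp add: pos_less_divide_eq)
    then show "lyapunov_bound < (d - n) / d * (d * b) powr p / p - (d - \<alpha>) * b\<^sup>2 / 2"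
      unfolding B by simp
  qed (use \<alpha>bar \<open>0 < b\<close> in auto)
qed

lemma is_solution_shooting:
  assumes "fast_diffusion (real N) p q" "0 < \<alpha>" "\<alpha> < delta p" "is_solution N p q \<alpha> a w" "a \<noteq> 0"
  obtains w' where "shooting (real N) p q \<alpha> (\<lambda>t. exp (delta p * t) * w (exp t))
      (\<lambda>t. - (exp ((delta p - 1) * t) * signed_power (p - 2) (w' (exp t))))"
    "\<And>r. 0 < r \<Longrightarrow> (w has_real_derivative w' r) (at r)" "continuous_on {0..} w" "w 0 = a"
proof -
  interpret fast_diffusion "real N" p q by fact
  obtain w' z' where w': "C1_halfline_deriv w w'"
    and z': "C1_halfline_deriv (\<lambda>r. signed_power (p - 2) (w' r)) z'"
    and ode: "\<And>r. 0 < r \<Longrightarrow> z' r + (real N - 1) / r * signed_power (p - 2) (w' r) + r * w' r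
                 + \<alpha> * w r + signed_power (q - 1) (w r) = 0"
    and init: "w 0 = a" "w' 0 = 0"
    using assms(4) unfolding is_solution_def by blast
  define X where "X r = signed_power (p - 2) (w' r)" for r
  have within: "at r within {0..} = at r" if "0 < r" for r :: real
    by (rule at_within_interior) (use that in simp)
  have wd: "(w has_real_derivative w' r) (at r)" and Xd: "(X has_real_derivative z' r) (at r)" if "0 < r" for r
    using w' z' that within[OF that] unfolding C1_halfline_deriv_def X_def[abs_def]
    by (metis less_imp_le)+
  have cont: "continuous_on {0..} w" "continuous_on {0..} X"
    using w' z' unfolding C1_halfline_deriv_def X_def[abs_def]
    by (meson DERIV_continuous_on atLeast_iff)+
  have at_bot: "((\<lambda>t. w (exp t)) \<longlongrightarrow> w 0) at_bot" "((\<lambda>t. X (exp t)) \<longlongrightarrow> X 0) at_bot"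
    by (rule continuous_on_tendsto_compose[OF cont(1) exp_at_bot], simp, simp)
       (rule continuous_on_tendsto_compose[OF cont(2) exp_at_bot], simp, simp)
  have exp0: "((\<lambda>t. exp (k * t)) \<longlongrightarrow> 0) at_bot" if "0 < k" for k :: real
    using that by (intro filterlim_compose[OF exp_at_bot]
      filterlim_tendsto_pos_mult_at_bot[OF tendsto_const _ filterlim_ident])
  let ?y = "\<lambda>t. exp (d * t) * w (exp t)" and ?Y = "\<lambda>t. - (exp ((d - 1) * t) * X (exp t))"
  have g: "g (?Y t) = - (exp ((d + 1) * t) * w' (exp t))" for t
  proof -
    have "g (exp ((d - 1) * t) * X (exp t)) = exp ((d - 1) * t) powr m * g (X (exp t))"
      using signed_power_mult[of "exp ((d - 1) * t)" "m - 1" "X (exp t)"] by simp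
    also have "exp ((d - 1) * t) powr m = exp ((d + 1) * t)"
      unfolding d_m[symmetric] by (simp add: exp_powr_real mult_ac)
    also have "g (X (exp t)) = w' (exp t)"
      unfolding X_def by (rule signed_power_signed_power) (use p in \<open>simp add: field_simps\<close>)
    finally show ?thesis by (simp add: signed_power_minus)
  qed
  have "shooting (real N) p q \<alpha> ?y ?Y"
  proof unfold_locales
    fix t
    have e: "exp (d * t) * exp t = exp ((d + 1) * t)" "exp ((d - 1) * t) * exp t = exp (d * t)"
      by (simp_all add: exp_add[symmetric] algebra_simps)
    have "(?y has_real_derivative d * exp (d * t) * w (exp t) + exp (d * t) * (w' (exp t) * exp t)) (at t)"
      by (auto intro!: derivative_eq_intros DERIV_chain2[OF wd] simp: algebra_simps)
    then show "(?y has_real_derivative d * ?y t - g (?Y t)) (at t)"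
      unfolding g e(1)[symmetric] by (simp add: mult_ac)
    have "(?Y has_real_derivative - ((d - 1) * exp ((d - 1) * t) * X (exp t)
        + exp ((d - 1) * t) * (z' (exp t) * exp t))) (at t)"
      by (auto intro!: derivative_eq_intros DERIV_chain2[OF Xd] simp: algebra_simps)
    moreover have "- ((d - 1) * exp ((d - 1) * t) * X (exp t) + exp ((d - 1) * t) * (z' (exp t) * exp t))
      = (d - real N) * ?Y t + (\<alpha> + exp (- c * t) * \<bar>?y t\<bar> powr (q - 1)) * ?y t - g (?Y t)"
    proof -
      have "exp (- c * t) * \<bar>?y t\<bar> powr (q - 1) = exp (- c * t) * exp (c * t) * \<bar>w (exp t)\<bar> powr (q - 1)"
        by (simp add: abs_mult powr_mult exp_powr_real mult_ac)
      then have src: "exp (- c * t) * \<bar>?y t\<bar> powr (q - 1) = \<bar>w (exp t)\<bar> powr (q - 1)"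
        by (simp add: exp_minus)
      have z: "z' (exp t) * exp t = - (real N - 1) * X (exp t) - exp t * (exp t * w' (exp t)
          + \<alpha> * w (exp t) + \<bar>w (exp t)\<bar> powr (q - 1) * w (exp t))"
      proof -
        have "z' (exp t) = - ((real N - 1) / exp t * X (exp t)) - (exp t * w' (exp t)
          + \<alpha> * w (exp t) + \<bar>w (exp t)\<bar> powr (q - 1) * w (exp t))"
          using ode[of "exp t"] by (simp add: X_def signed_power_def)
        then show ?thesis by (simp add: field_simps)
      qed
      show ?thesis
        unfolding src g z unfolding e(1)[symmetric] e(2)[symmetric] by (simp add: algebra_simps)
    qed
    ultimately show "(?Y has_real_derivative
        (d - real N) * ?Y t + (\<alpha> + exp (- c * t) * \<bar>?y t\<bar> powr (q - 1)) * ?y t - g (?Y t)) (at t)"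
      by simp
  next
    show "(?y \<longlongrightarrow> 0) at_bot"
      using tendsto_mult[OF exp0[of d] at_bot(1)] d_gt by simp
    show "(?Y \<longlongrightarrow> 0) at_bot"
      using tendsto_minus[OF tendsto_mult[OF exp0[of "d - 1"] at_bot(2)]] d_gt by simp
    have "((\<lambda>t. exp (2 * d * t) * \<bar>w (exp t)\<bar> powr (q + 1)) \<longlongrightarrow> 0 * \<bar>w 0\<bar> powr (q + 1)) at_bot"
      by (intro tendsto_mult exp0 tendsto_powr' tendsto_rabs at_bot tendsto_const) (use d_gt q in auto)
    \<comment> \<open>The exponents add up to \<open>d * (q + 1) - c = 2 * d\<close>, which is
      positive: the growth of \<open>exp (- c * t)\<close> at minus infinity is outweighed.\<close>
    moreover have "exp (2 * d * t) * \<bar>w (exp t)\<bar> powr (q + 1) = exp (- c * t) * \<bar>?y t\<bar> powr (q + 1)" for t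
    proof -
      have "exp (- c * t) * \<bar>?y t\<bar> powr (q + 1) = exp (- c * t) * exp (d * t * (q + 1)) * \<bar>w (exp t)\<bar> powr (q + 1)"
        by (simp add: abs_mult powr_mult exp_powr_real)
      also have "exp (- c * t) * exp (d * t * (q + 1)) = exp (2 * d * t)"
        by (simp add: exp_add[symmetric] algebra_simps)
      finally show ?thesis by simp
    qed
    ultimately show "((\<lambda>t. exp (- c * t) * \<bar>?y t\<bar> powr (q + 1)) \<longlongrightarrow> 0) at_bot" by simp
    have "\<forall>\<^sub>F t in at_bot. w (exp t) \<noteq> 0"
      by (rule tendsto_imp_eventually_ne[OF at_bot(1)]) (use init assms in simp)
    then show "\<exists>t. \<forall>s\<le>t. ?y s \<noteq> 0" by (auto simp: eventually_at_bot_linorder)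
  qed (use assms in auto)
  then show ?thesis
    unfolding X_def by (rule that) (use wd cont init in auto)
qed

text \<open>Infinitely many zeros in a bounded range would accumulate at a positive zero, the value
  at 0 being nonzero. There \<open>w'\<close> is nonzero because \<open>y\<close> and
  \<open>Y\<close> never vanish together, so that zero is isolated.\<close>

lemma infinite_zeros_iff:
  assumes "fast_diffusion (real N) p q" "0 < \<alpha>" "\<alpha> < delta p" "is_solution N p q \<alpha> a w" "a \<noteq> 0"
  shows "infinite (zeros w) \<longleftrightarrow> (\<forall>s. \<exists>t\<ge>s. exp (delta p * t) * w (exp t) = 0)"
proof -
  obtain w' where sh: "shooting (real N) p q \<alpha> (\<lambda>t. exp (delta p * t) * w (exp t))
      (\<lambda>t. - (exp ((delta p - 1) * t) * signed_power (p - 2) (w' (exp t))))"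
    and wd: "\<And>r. 0 < r \<Longrightarrow> (w has_real_derivative w' r) (at r)"
    and cont: "continuous_on {0..} w" and "w 0 = a"
    using is_solution_shooting[OF assms] by blast
  interpret shooting "real N" p q \<alpha> "\<lambda>t. exp (delta p * t) * w (exp t)"
      "\<lambda>t. - (exp ((delta p - 1) * t) * signed_power (p - 2) (w' (exp t)))" by (rule sh)
  have zeros_pos: "0 < r" if "r \<in> zeros w" for r
    using that \<open>w 0 = a\<close> \<open>a \<noteq> 0\<close> by (cases "r = 0") (auto simp: zeros_def)
  show ?thesis
  proof
    assume inf: "infinite (zeros w)"
    show "\<forall>s. \<exists>t\<ge>s. exp (delta p * t) * w (exp t) = 0"
    proof (rule ccontr)
      assume "\<not> (\<forall>s. \<exists>t\<ge>s. exp (delta p * t) * w (exp t) = 0)"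
      then obtain s where s: "\<And>t. s \<le> t \<Longrightarrow> w (exp t) \<noteq> 0" by auto
      have "r \<le> exp s" if "r \<in> zeros w" for r
      proof (rule ccontr)
        assume "\<not> r \<le> exp s"
        then have "s \<le> ln r" using zeros_pos[OF that] by (simp add: ln_ge_iff)
        from s[OF this] that zeros_pos[OF that] show False by (simp add: zeros_def)
      qed
      then have "zeros w \<subseteq> {0..exp s}" by (auto simp: zeros_def)
      then obtain r where r: "r islimpt zeros w"
        using compact_Icc[of 0 "exp s"] inf unfolding compact_eq_Bolzano_Weierstrass by blast
      have "closed (zeros w)"
        using continuous_closed_preimage_constant[OF cont closed_atLeast, of 0]
        by (simp add: zeros_def)
      with r have "r \<in> zeros w" by (simp add: closed_limpt)
      then have "0 < r" "w r = 0" using zeros_pos by (auto simp: zeros_def)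
      then have "w' r \<noteq> 0"
        using not_both_0[of "ln r"] by (auto simp: signed_power_def)
      have "((\<lambda>x. (w x - w r) / (x - r)) \<longlongrightarrow> w' r) (at r)"
        using wd[OF \<open>0 < r\<close>] by (simp add: has_field_derivative_iff)
      then have "\<forall>\<^sub>F x in at r. (w x - w r) / (x - r) \<noteq> 0"
        using \<open>w' r \<noteq> 0\<close> by (rule tendsto_imp_eventually_ne)
      then have "\<forall>\<^sub>F x in at r. x \<notin> zeros w"
        by eventually_elim (auto simp: zeros_def \<open>w r = 0\<close>)
      with r show False by (simp add: islimpt_iff_eventually)
    qed
  next
    assume unbdd: "\<forall>s. \<exists>t\<ge>s. exp (delta p * t) * w (exp t) = 0"
    show "infinite (zeros w)"
    proof
      assume "finite (zeros w)"
      then obtain M where M: "\<And>r. r \<in> zeros w \<Longrightarrow> r \<le> M"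
        using bdd_above_finite unfolding bdd_above_def by blast
      obtain t where t: "M \<le> t" "w (exp t) = 0" using unbdd by auto
      have "exp t \<le> M" using t by (intro M) (auto simp: zeros_def)
      then show False using exp_ge_add_one_self[of t] t by simp
    qed
  qed
qed

theorem theorem3p15:
  fixes N :: nat and p q :: real
  assumes "1 \<le> N" and "1 < p" and "p < 2" and "1 < q" and "real N < delta p"
  shows "(\<forall>\<alpha> a w. real N \<le> \<alpha> \<and> \<alpha> < delta p \<and> \<alpha> < alpha_star N p \<and> a \<noteq> 0 \<and>
              is_solution N p q \<alpha> a w \<longrightarrow> finite (zeros w)) \<and>
         (\<exists>\<alpha>bar. max (real N) (alpha_star N p) < \<alpha>bar \<and> \<alpha>bar < delta p \<and>
            (\<forall>\<alpha> a w. \<alpha>bar < \<alpha> \<and> \<alpha> < delta p \<and> a \<noteq> 0 \<and>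
               is_solution N p q \<alpha> a w \<longrightarrow> infinite (zeros w)))"
proof -
  have fd: "fast_diffusion (real N) p q"
    using assms by unfold_locales auto
  interpret fast_diffusion "real N" p q by (rule fd)
  have k: "0 < (p - 1) * k" using k_pos p by simp
  have "d * (real N - d) / ((p - 1) * k) < 0"
    using k d_gt n_less by (intro divide_neg_pos mult_pos_neg) auto
  then have "max (real N) (alpha_star N p) < d"
    using n_less by (simp add: alpha_star_def)
  from exists_threshold[OF this] obtain \<alpha>bar b where \<alpha>bar:
    "max (real N) (alpha_star N p) < \<alpha>bar" "\<alpha>bar < d" and "0 < b"
    and thr: "\<And>\<alpha>. \<alpha>bar < \<alpha> \<Longrightarrow>
        lyapunov_bound < (d - real N) / d * (d * b) powr p / p - (d - \<alpha>) * b\<^sup>2 / 2"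
      "\<And>\<alpha>. \<alpha>bar < \<alpha> \<Longrightarrow> (d - \<alpha>) * b < (d - real N) * \<phi> b"
    by blast
  have fin: "finite (zeros w)" if \<alpha>_bounds: "real N \<le> \<alpha>" "\<alpha> < d" "\<alpha> < alpha_star N p"
    and sol: "a \<noteq> 0" "is_solution N p q \<alpha> a w" for \<alpha> a w
  proof (rule ccontr)
    assume inf: "infinite (zeros w)"
    have "0 < \<alpha>" using n \<alpha>_bounds by simp
    note unbdd = infinite_zeros_iff[OF fd \<open>0 < \<alpha>\<close> \<alpha>_bounds(2) sol(2,1), THEN iffD1, OF inf, rule_format]
    obtain w' where "shooting (real N) p q \<alpha> (\<lambda>t. exp (delta p * t) * w (exp t))
      (\<lambda>t. - (exp ((delta p - 1) * t) * signed_power (p - 2) (w' (exp t))))"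
      using is_solution_shooting[OF fd \<open>0 < \<alpha>\<close> \<alpha>_bounds(2) sol(2,1)] by blast
    then interpret shooting "real N" p q \<alpha> "\<lambda>t. exp (delta p * t) * w (exp t)"
      "\<lambda>t. - (exp ((delta p - 1) * t) * signed_power (p - 2) (w' (exp t)))" .
    \<comment> \<open>This is the inequality \<open>\<alpha> < alpha_star N p\<close> rearranged
      into positivity of the trace.\<close>
    have "m * (d * (d - real N) / (d - \<alpha>)) < k"
    proof -
      have "d * (d - real N) / ((p - 1) * k) < d - \<alpha>"
        using \<alpha>_bounds(3) minus_divide_left[of "d * (d - real N)" "(p - 1) * k"]
        by (simp add: alpha_star_def right_diff_distrib)
      then have "d * (d - real N) < (d - \<alpha>) * ((p - 1) * k)"
        using k by (simp add: pos_divide_less_eq)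
      then have "d * (d - real N) / (d - \<alpha>) < (p - 1) * k"
        using \<alpha>_bounds by (simp add: pos_divide_less_eq mult.commute)
      moreover have "x < (p - 1) * f \<Longrightarrow> m * x < f" for x f :: real
        using p by (simp add: pos_divide_less_eq mult.commute)
      ultimately show ?thesis by blast
    qed
    from zeros_bounded[OF \<alpha>_bounds(1) this] unbdd show False by blast
  qed
  have inf: "infinite (zeros w)" if \<alpha>_bounds: "\<alpha>bar < \<alpha>" "\<alpha> < d"
    and sol: "a \<noteq> 0" "is_solution N p q \<alpha> a w" for \<alpha> a w
  proof -
    have "0 < \<alpha>" using n \<alpha>_bounds \<alpha>bar by simp
    obtain w' where "shooting (real N) p q \<alpha> (\<lambda>t. exp (delta p * t) * w (exp t))
      (\<lambda>t. - (exp ((delta p - 1) * t) * signed_power (p - 2) (w' (exp t))))"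
      using is_solution_shooting[OF fd \<open>0 < \<alpha>\<close> \<alpha>_bounds(2) sol(2,1)] by blast
    then interpret shooting "real N" p q \<alpha> "\<lambda>t. exp (delta p * t) * w (exp t)"
      "\<lambda>t. - (exp ((delta p - 1) * t) * signed_power (p - 2) (w' (exp t)))" .
    show ?thesis
      unfolding infinite_zeros_iff[OF fd \<open>0 < \<alpha>\<close> \<alpha>_bounds(2) sol(2,1)]
      using oscillates[OF \<open>0 < b\<close> thr[OF \<alpha>_bounds(1)]] by blast
  qed
  show ?thesis
    using fin inf \<alpha>bar by blast
qed

end
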